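(* Let $q$ be a power of an odd prime and let $v_{O,n}$ be one half of the sum of the average order of an element of $O^+(n,q)$ and the average order of an element of $O^-(n,q)$. For fixed $q$ and growing $n$, $$\log(v_{O,n})\ \geq\ \tfrac n2\log(q)-\log(n)+o(\log(n)).$$
   Context: Averages are with respect to the uniform distribution, and the order of an element is its order as a group element. Let $\delta$ be a non-square in $F_q$. For $n=2l+1$ odd, $O^+(n,q)$ and $O^-(n,q)$ are the subgroups of $GL(n,q)$ preserving the non-degenerate symmetric bilinear forms with matrices $A$ and $\delta A$ respectively, where $A$ is the orthogonal sum of $(1)$ and $\begin{pmatrix}0_l & I_l \\ I_l & 0_l\end{pmatrix}$ (the two groups are isomorphic). For $n=2l$ even, $O^+(n,q)$ preserves the form with matrix $\begin{pmatrix}0_l & I_l \\ I_l & 0_l\end{pmatrix}$ and $O^-(n,q)$ the form which is the orthogonal sum of $\begin{pmatrix}0_{l-1} & I_{l-1} \\ I_{l-1} & 0_{l-1}\end{pmatrix}$ and $\mathrm{diag}(1,-\delta)$. *)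

theory Defs
  imports
    "Jordan_Normal_Form.Matrix"
    "HOL-Algebra.Multiplicative_Group"
    "HOL-Computational_Algebra.Primes"
    "HOL-Library.Landau_Symbols"
begin

definition GL :: "'k::field itself \<Rightarrow> nat \<Rightarrow> 'k mat monoid" where
  "GL ty n = units_of (ring_mat ty n ())"

definition bilinear_form :: "'k::field mat \<Rightarrow> 'k vec \<Rightarrow> 'k vec \<Rightarrow> 'k" where
  "bilinear_form A x y = x \<bullet> (A *\<^sub>v y)"

definition isometries :: "nat \<Rightarrow> 'k::field mat \<Rightarrow> 'k mat set" where
  "isometries n A = {g \<in> carrier (GL TYPE('k) n).
     \<forall>x \<in> carrier_vec n. \<forall>y \<in> carrier_vec n.
       bilinear_form A (g *\<^sub>v x) (g *\<^sub>v y) = bilinear_form A x y}"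

definition isometry_group :: "nat \<Rightarrow> 'k::field mat \<Rightarrow> 'k mat monoid" where
  "isometry_group n A = (GL TYPE('k) n)\<lparr>carrier := isometries n A\<rparr>"

definition hyperbolic_mat :: "nat \<Rightarrow> 'k::field mat" where
  "hyperbolic_mat l = four_block_mat (0\<^sub>m l l) (1\<^sub>m l) (1\<^sub>m l) (0\<^sub>m l l)"

definition O_plus_form :: "nat \<Rightarrow> 'k::field mat" where
  "O_plus_form n =
     (if odd n then diag_block_mat [1\<^sub>m 1, hyperbolic_mat (n div 2)]
      else hyperbolic_mat (n div 2))"

text \<open>For \<open>n = 0\<close> there is no form of minus type: the even branch then yields a
  \<open>2 \<times> 2\<close> matrix and the definition is meaningful only for \<open>n > 0\<close>.\<close>

definition O_minus_form :: "'k::field \<Rightarrow> nat \<Rightarrow> 'k mat" where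
  "O_minus_form \<delta> n =
     (if odd n then \<delta> \<cdot>\<^sub>m O_plus_form n
      else diag_block_mat [hyperbolic_mat (n div 2 - 1), mat_of_rows_list 2 [[1, 0], [0, - \<delta>]]])"

definition O_plus :: "'k::field itself \<Rightarrow> nat \<Rightarrow> 'k mat monoid" where
  "O_plus ty n = isometry_group n (O_plus_form n)"

definition O_minus :: "'k::field \<Rightarrow> nat \<Rightarrow> 'k mat monoid" where
  "O_minus \<delta> n = isometry_group n (O_minus_form \<delta> n)"

definition average_order :: "('g, 'm) monoid_scheme \<Rightarrow> real" where
  "average_order G = (\<Sum>g \<in> carrier G. real (group.ord G g)) / real (card (carrier G))"

definition v_O :: "'k::field \<Rightarrow> nat \<Rightarrow> real" where
  "v_O \<delta> n = (average_order (O_plus TYPE('k) n) + average_order (O_minus \<delta> n)) / 2"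

lemma O_plus_form_carrier: "O_plus_form n \<in> carrier_mat n n"
proof (cases "odd n")
  case True
  then have "Suc (n div 2 + n div 2) = n" by presburger
  then show ?thesis
    using True by (intro carrier_matI) (simp_all add: O_plus_form_def hyperbolic_mat_def Let_def)
next
  case False
  then have "n div 2 + n div 2 = n" by presburger
  then show ?thesis
    using False by (intro carrier_matI) (simp_all add: O_plus_form_def hyperbolic_mat_def)
qed

lemma O_minus_form_carrier:
  assumes "n > 0"
  shows "O_minus_form \<delta> n \<in> carrier_mat n n"
proof (cases "odd n")
  case True
  then show ?thesis by (simp add: O_minus_form_def O_plus_form_carrier)
next
  case False
  then have "n div 2 - 1 + (n div 2 - 1) + 2 = n" using assms by presburger
  then show ?thesis
    using False
    by (intro carrier_matI)
      (simp_all add: O_minus_form_def hyperbolic_mat_def mat_of_rows_list_def Let_def)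
qed

lemma carrier_GL: "carrier (GL TYPE('k::field) n) =
    {g \<in> carrier_mat n n. \<exists>h \<in> carrier_mat n n. h * g = 1\<^sub>m n \<and> g * h = 1\<^sub>m n}"
  by (auto simp: GL_def units_of_def Units_def ring_mat_def)

lemma group_GL: "group (GL TYPE('k::field) n)"
proof -
  interpret ring "ring_mat TYPE('k) n ()" by (rule ring_mat)
  show ?thesis unfolding GL_def by (rule units_group)
qed

lemma mult_GL: "mult (GL TYPE('k::field) n) = (*)"
  and one_GL: "one (GL TYPE('k::field) n) = 1\<^sub>m n"
  by (simp_all add: GL_def units_of_def ring_mat_def)

lemma subgroup_isometries:
  fixes A :: "'k::field mat"
  shows "subgroup (isometries n A) (GL TYPE('k) n)"
proof -
  interpret G: group "GL TYPE('k) n" by (rule group_GL)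
  show ?thesis
  proof (rule G.subgroupI)
    show "isometries n A \<subseteq> carrier (GL TYPE('k) n)" by (auto simp: isometries_def)
    have "1\<^sub>m n \<in> isometries n A"
      using G.one_closed by (simp add: isometries_def one_GL)
    then show "isometries n A \<noteq> {}" by blast
  next
    fix g assume g: "g \<in> isometries n A"
    define h where "h = inv\<^bsub>GL TYPE('k) n\<^esub> g"
    have gG: "g \<in> carrier (GL TYPE('k) n)" using g by (simp add: isometries_def)
    then have hG: "h \<in> carrier (GL TYPE('k) n)" by (simp add: h_def)
    have gc: "g \<in> carrier_mat n n" and hc: "h \<in> carrier_mat n n"
      using gG hG by (auto simp: carrier_GL)
    have gh: "g * h = 1\<^sub>m n"
      using G.r_inv[OF gG] by (simp add: h_def mult_GL one_GL)
    have "bilinear_form A (h *\<^sub>v x) (h *\<^sub>v y) = bilinear_form A x y"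
      if x: "x \<in> carrier_vec n" and y: "y \<in> carrier_vec n" for x y
    proof -
      have "h *\<^sub>v x \<in> carrier_vec n" "h *\<^sub>v y \<in> carrier_vec n" using hc x y by auto
      then have "bilinear_form A (h *\<^sub>v x) (h *\<^sub>v y) =
          bilinear_form A (g *\<^sub>v (h *\<^sub>v x)) (g *\<^sub>v (h *\<^sub>v y))"
        using g by (simp add: isometries_def)
      also have "g *\<^sub>v (h *\<^sub>v x) = x"
        using assoc_mult_mat_vec[OF gc hc x] gh x by simp
      also have "g *\<^sub>v (h *\<^sub>v y) = y"
        using assoc_mult_mat_vec[OF gc hc y] gh y by simp
      finally show ?thesis .
    qed
    then show "inv\<^bsub>GL TYPE('k) n\<^esub> g \<in> isometries n A"
      using hG by (simp add: isometries_def h_def)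
  next
    fix g h assume g: "g \<in> isometries n A" and h: "h \<in> isometries n A"
    have gG: "g \<in> carrier (GL TYPE('k) n)" and hG: "h \<in> carrier (GL TYPE('k) n)"
      using g h by (auto simp: isometries_def)
    then have gc: "g \<in> carrier_mat n n" and hc: "h \<in> carrier_mat n n"
      by (auto simp: carrier_GL)
    have "g * h \<in> carrier (GL TYPE('k) n)"
      using G.m_closed[OF gG hG] by (simp add: mult_GL)
    moreover have "bilinear_form A ((g * h) *\<^sub>v x) ((g * h) *\<^sub>v y) = bilinear_form A x y"
      if x: "x \<in> carrier_vec n" and y: "y \<in> carrier_vec n" for x y
    proof -
      have "h *\<^sub>v x \<in> carrier_vec n" "h *\<^sub>v y \<in> carrier_vec n" using hc x y by auto
      then show ?thesis
        using g h x y
        by (simp add: isometries_def assoc_mult_mat_vec[OF gc hc])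
    qed
    ultimately show "g \<otimes>\<^bsub>GL TYPE('k) n\<^esub> h \<in> isometries n A"
      by (simp add: isometries_def mult_GL)
  qed
qed

lemma group_isometry_group: "group (isometry_group n A)"
  unfolding isometry_group_def
  by (rule group.subgroup_imp_group[OF group_GL subgroup_isometries])

end

theory Submission
  imports Defs
    "HOL-Number_Theory.Totient"
    "HOL-Real_Asymp.Real_Asymp"
    "HOL-Algebra.Algebraic_Closure_Type"
    "Jordan_Normal_Form.Char_Poly"
    "HOL-Number_Theory.Residues"
begin

text \<open>Only \<open>O\<^sup>+(n, q)\<close> is needed: it makes up half of \<open>v\<^bsub>O,n\<^esub>\<close>. Write \<open>n = s + 2l\<close> with \<open>s \<le> 1\<close> and
  let \<open>L\<close> be the extension of \<open>F\<^sub>q\<close> of degree \<open>l\<close>. The units \<open>x\<close> of \<open>L\<close> embed in \<open>O\<^sup>+(n, q)\<close> as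
  \<open>t(x) = diag(1, M, M\<^sup>-\<^sup>T)\<close>, where \<open>M\<close> is the matrix of multiplication by \<open>x\<close>. For each of the
  \<open>\<phi>(q\<^sup>l - 1)\<close> generators \<open>x\<close> of the cyclic group of units, \<open>t(x)\<close> has order \<open>q\<^sup>l - 1\<close> and a centralizer of
  order at most \<open>q\<^bsup>s + l\<^esup>\<close>; and at most \<open>n\<close> of the \<open>t(x)\<close> are conjugate to any given element, because
  \<open>x\<close> is a root of the characteristic polynomial of \<open>t(x)\<close>. Hence the average order is at least
  \<open>(q\<^sup>l - 1) \<phi>(q\<^sup>l - 1) / (n q\<^bsup>s + l\<^esup>)\<close>. Chebyshev's bound for primes in dyadic intervals gives
  \<open>\<phi>(N) / N \<ge> c (log log N)\<^sup>-\<^sup>4\<close>; for \<open>N = q\<^sup>l - 1\<close> this costs only \<open>O(log log n)\<close> after taking logarithms.\<close>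

hide_const (open) Divisibility.prime Ring_Divisibility.mult_of

section \<open>A lower bound for the totient function\<close>

lemma prod_distinct_primes_dvd:
  fixes m :: nat
  assumes "finite S" "\<And>p. p \<in> S \<Longrightarrow> prime p \<and> p dvd m"
  shows "\<Prod>S dvd m"
  using assms
proof (induction S rule: finite_induct)
  case (insert p S)
  have "coprime p (\<Prod>S)"
    using insert by (intro prod_coprime_right) (metis insertCI primes_coprime)
  then show ?case
    using insert by (simp add: divides_mult)
qed simp

text \<open>Chebyshev's argument: with \<open>m = 2 ^ j\<close>, each prime in the interval divides
  the central binomial coefficient \<open>2 * m choose m\<close>, which is at most
  \<open>2 ^ (2 * m)\<close>. Since each prime exceeds \<open>2 ^ j\<close>, there are at most
  \<open>2 * m / j\<close> of them, and each contributes at most \<open>1 / m\<close>.\<close>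

lemma sum_inverse_primes_dyadic:
  fixes j :: nat
  assumes "j \<ge> 1"
  shows "(\<Sum>p | prime p \<and> 2 ^ j < p \<and> p \<le> 2 ^ Suc j. 1 / real p) \<le> 2 / real j"
proof -
  define m :: nat where "m = 2 ^ j"
  define S where "S = {p::nat. prime p \<and> 2 ^ j < p \<and> p \<le> 2 ^ Suc j}"
  have fin: "finite S" by (rule finite_subset[of _ "{..2 ^ Suc j}"]) (auto simp: S_def)
  have "\<Prod>S dvd (2 * m choose m)"
  proof (rule prod_distinct_primes_dvd[OF fin])
    fix p assume "p \<in> S"
    then have p: "prime p" "m < p" "p \<le> 2 * m" by (auto simp: S_def m_def)
    have "p dvd fact (2 * m)" using p by (simp add: prime_dvd_fact_iff)
    also have "fact (2 * m) = fact m * fact m * (2 * m choose m)"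
      using binomial_fact_lemma[of m "2 * m"] by (simp add: mult_2)
    finally have "p dvd (2 * m choose m)"
      using p by (simp add: prime_dvd_mult_iff prime_dvd_fact_iff)
    with p show "prime p \<and> p dvd (2 * m choose m)" by simp
  qed
  then have "\<Prod>S \<le> (2 * m choose m)" by (intro dvd_imp_le) simp_all
  also have "\<dots> \<le> 2 ^ (2 * m)" by (rule binomial_le_pow2)
  finally have "\<Prod>S \<le> 2 ^ (2 * m)" .
  moreover have "(2 ^ j) ^ card S \<le> \<Prod>S"
    using prod_mono[of S "\<lambda>_. 2 ^ j" "\<lambda>p. p"] by (auto simp: S_def)
  ultimately have "(2::nat) ^ (j * card S) \<le> 2 ^ (2 * m)" by (simp add: power_mult)
  then have "j * card S \<le> 2 * m" by (simp add: power_increasing_iff)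
  then have "real j * real (card S) \<le> 2 * real m"
    by (metis of_nat_le_iff of_nat_mult of_nat_numeral)
  then have "real (card S) / real m \<le> 2 / real j"
    using assms by (simp add: field_simps m_def)
  moreover have "(\<Sum>p\<in>S. 1 / real p) \<le> (\<Sum>p\<in>S. 1 / real m)"
  proof (rule sum_mono)
    fix p assume "p \<in> S"
    then have "m < p" "m > 0" by (auto simp: S_def m_def)
    then show "1 / real p \<le> 1 / real m" by (simp add: field_simps)
  qed
  ultimately show ?thesis unfolding S_def by simp
qed

text \<open>A weak form of Mertens' theorem: the dyadic blocks contribute a harmonic sum, which is
  compared with \<open>2 * ln J\<close>.\<close>

lemma sum_inverse_primes_le:
  fixes J :: nat
  assumes "J \<ge> 1"
  shows "(\<Sum>p | prime p \<and> p \<le> 2 ^ Suc J. 1 / real p) \<le> 3 + 2 * ln (real J)"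
  using assms
proof (induction J rule: dec_induct)
  case base
  have "{p::nat. prime p \<and> p \<le> 2 ^ Suc 1} \<subseteq> {2, 3}"
  proof
    fix p :: nat assume "p \<in> {p. prime p \<and> p \<le> 2 ^ Suc 1}"
    then have p: "prime p" "p \<le> 4" by auto
    then have "p \<noteq> 4" "p \<ge> 2" using prime_ge_2_nat prime_nat_not_dvd[of 4 2] by auto
    with p show "p \<in> {2, 3}" by auto
  qed
  then have "(\<Sum>p | prime p \<and> p \<le> 2 ^ Suc 1. 1 / real p) \<le> (\<Sum>p\<in>{2, 3}. 1 / real p)"
    by (intro sum_mono2) auto
  then show ?case by simp
next
  case (step J)
  have "{p::nat. prime p \<and> p \<le> 2 ^ Suc (Suc J)} = {p. prime p \<and> p \<le> 2 ^ Suc J} \<union>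
      {p. prime p \<and> 2 ^ Suc J < p \<and> p \<le> 2 ^ Suc (Suc J)}" by auto
  then have "(\<Sum>p | prime p \<and> p \<le> 2 ^ Suc (Suc J). 1 / real p) =
      (\<Sum>p | prime p \<and> p \<le> 2 ^ Suc J. 1 / real p) +
      (\<Sum>p | prime p \<and> 2 ^ Suc J < p \<and> p \<le> 2 ^ Suc (Suc J). 1 / real p)"
    by (simp only:) (subst sum.union_disjoint; auto)
  also have "\<dots> \<le> (3 + 2 * ln (real J)) + 2 / real (Suc J)"
    using step.IH sum_inverse_primes_dyadic[of "Suc J"] by linarith
  \<comment> \<open>This is \<open>ln t \<le> t - 1\<close> at \<open>t = J / (J + 1)\<close>, which
    makes the logarithms telescope.\<close>
  also have "2 / real (Suc J) \<le> 2 * (ln (real (Suc J)) - ln (real J))"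
  proof -
    have "ln (real J / real (Suc J)) \<le> real J / real (Suc J) - 1"
      using step by (intro ln_le_minus_one) auto
    then show ?thesis using step by (simp add: ln_div field_simps)
  qed
  finally show ?case by simp
qed

text \<open>Each Euler factor \<open>1 - 1 / p\<close> is at least \<open>exp (- 2 / p)\<close>, so
  it suffices to bound the sum of \<open>1 / p\<close> over the prime divisors by
  \<open>4 + 2 * ln J\<close>. The primes up to \<open>2 ^ Suc J\<close> give
  \<open>3 + 2 * ln J\<close>. The larger ones number at most \<open>2 ^ Suc J\<close>, because
  their product is at most \<open>N\<close>, and so contribute at most 1.\<close>

lemma totient_lower_bound:
  fixes N J :: nat
  assumes "N \<ge> 1" "J \<ge> 1" "N \<le> 2 ^ (2 ^ Suc J)"
  shows "real (totient N) \<ge> real N * exp (- 8 - 4 * ln (real J))"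
proof -
  define P where "P = prime_factors N"
  define P1 where "P1 = {p \<in> P. p \<le> 2 ^ Suc J}"
  define P2 where "P2 = {p \<in> P. p > 2 ^ Suc J}"
  have pr: "prime p \<and> p dvd N" if "p \<in> P" for p using that by (auto simp: P_def)
  have fin: "finite P" "finite P1" "finite P2" by (auto simp: P_def P1_def P2_def)
  have "(\<Sum>p\<in>P1. 1 / real p) \<le> (\<Sum>p | prime p \<and> p \<le> 2 ^ Suc J. 1 / real p)"
    by (intro sum_mono2) (auto simp: P1_def P_def)
  also have "\<dots> \<le> 3 + 2 * ln (real J)" by (rule sum_inverse_primes_le) fact
  finally have S1: "(\<Sum>p\<in>P1. 1 / real p) \<le> 3 + 2 * ln (real J)" .
  have "2 ^ card P2 \<le> \<Prod>P2"
    using prod_mono[of P2 "\<lambda>_. 2" "\<lambda>p. p"] pr by (simp add: P2_def prime_ge_2_nat)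
  also have "\<Prod>P2 \<le> N"
    using assms pr by (intro dvd_imp_le prod_distinct_primes_dvd) (auto simp: P2_def P_def)
  also note assms(3)
  finally have c: "card P2 \<le> 2 ^ Suc J" by (simp add: power_increasing_iff)
  have "(\<Sum>p\<in>P2. 1 / real p) \<le> (\<Sum>p\<in>P2. 1 / 2 ^ Suc J)"
  proof (rule sum_mono)
    fix p assume "p \<in> P2"
    then have "real (2 ^ Suc J) \<le> real p" unfolding P2_def by (intro of_nat_mono) auto
    then show "1 / real p \<le> 1 / 2 ^ Suc J" by (intro frac_le) simp_all
  qed
  also have "\<dots> \<le> 1"
  proof -
    have "real (card P2) \<le> real (2 ^ Suc J)" using c by (rule of_nat_mono)
    then show ?thesis by simp
  qed
  finally have S2: "(\<Sum>p\<in>P2. 1 / real p) \<le> 1" .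
  have "P = P1 \<union> P2" "P1 \<inter> P2 = {}" by (auto simp: P1_def P2_def)
  then have S: "(\<Sum>p\<in>P. 1 / real p) \<le> 4 + 2 * ln (real J)"
    using S1 S2 fin by (simp add: sum.union_disjoint)
  have "exp (- 8 - 4 * ln (real J)) \<le> exp (\<Sum>p\<in>P. - (2 / real p))"
  proof -
    have "(\<Sum>p\<in>P. - (2 / real p)) = - 2 * (\<Sum>p\<in>P. 1 / real p)"
      by (subst sum_distrib_left) simp
    then show ?thesis using S by simp
  qed
  also have "\<dots> = (\<Prod>p\<in>P. exp (- (2 / real p)))" using fin by (simp add: exp_sum)
  also have "\<dots> \<le> (\<Prod>p\<in>P. 1 - 1 / real p)"
  proof (rule prod_mono, safe)
    fix p assume "p \<in> P"
    then have p: "p \<ge> 2" using pr prime_ge_2_nat by blast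
    define x where "x = 1 / real p"
    have x: "0 < x" "x \<le> 1 / 2" using p by (auto simp: x_def field_simps)
    \<comment> \<open>Here \<open>x \<le> 1 / 2\<close> is used, that is,
      \<open>p \<ge> 2\<close>.\<close>
    have "- (2 * x) \<le> - x - 2 * x\<^sup>2"
      using mult_left_mono[of x "1/2" x] x by (simp add: power2_eq_square)
    also have "\<dots> \<le> ln (1 - x)" using x by (intro ln_one_minus_pos_lower_bound) auto
    finally have "exp (- (2 * x)) \<le> exp (ln (1 - x))" by (simp only: exp_le_cancel_iff)
    also have "\<dots> = 1 - x" using x by simp
    finally show "exp (- (2 / real p)) \<le> 1 - 1 / real p" by (simp add: x_def)
  qed simp
  finally have "exp (- 8 - 4 * ln (real J)) \<le> (\<Prod>p\<in>P. 1 - 1 / real p)" .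
  then show ?thesis
    using totient_formula2[of N] by (simp add: P_def mult_left_mono)
qed

section \<open>Finite fields\<close>

lemma prime_CHAR_finite_field: "prime CHAR('k::{field,finite})"
  by (intro prime_CHAR_semidom finite_imp_CHAR_pos finite_class.finite_UNIV)

text \<open>Multiplication by a nonzero \<open>x\<close> permutes the nonzero elements, hence fixes
  their product.\<close>

lemma power_card_eq_self:
  fixes x :: "'k::{field,finite}"
  shows "x ^ card (UNIV :: 'k set) = x"
proof (cases "x = 0")
  case True
  then show ?thesis by (simp add: finite_UNIV_card_ge_0)
next
  case False
  have "x ^ (card (UNIV :: 'k set) - 1) * \<Prod>(UNIV - {0 :: 'k}) = (\<Prod>y\<in>UNIV - {0}. x * y)"
    by (simp add: prod.distrib card_Diff_singleton)
  also have "\<dots> = \<Prod>(UNIV - {0})"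
    by (rule prod.reindex_bij_witness[of _ "\<lambda>y. y / x" "\<lambda>y. x * y"]) (use False in auto)
  finally have "x ^ (card (UNIV :: 'k set) - 1) = 1" by simp
  then have "x ^ Suc (card (UNIV :: 'k set) - 1) = x" by simp
  then show ?thesis by (simp add: finite_UNIV_card_ge_0)
qed

text \<open>The polynomial splits into linear factors, and a repeated factor would give a common
  root of \<open>p\<close> and its derivative.\<close>

lemma card_roots_separable:
  fixes p :: "'K::alg_closed_field poly"
  assumes "p \<noteq> 0" and sep: "\<And>x. poly p x = 0 \<Longrightarrow> poly (pderiv p) x \<noteq> 0"
  shows "card {x. poly p x = 0} = degree p"
proof -
  obtain A where A: "size A = degree p" "p = smult (lead_coeff p) (\<Prod>x\<in>#A. [:- x, 1:])"
    using alg_closed_imp_factorization[OF assms(1)] by blast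
  define c where "c = lead_coeff p"
  have c: "c \<noteq> 0" using assms by (simp add: c_def)
  have pA: "p = smult c (\<Prod>x\<in>#A. [:- x, 1:])" using A(2) by (simp add: c_def)
  have "poly p x = c * (\<Prod>y\<in>#A. x - y)" for x
    unfolding pA by (simp add: poly_prod_mset multiset.map_comp o_def)
  then have roots: "{x. poly p x = 0} = set_mset A" using c by auto
  have "count A x \<le> 1" for x
  proof (rule ccontr)
    assume "\<not> count A x \<le> 1"
    then have "count A x \<ge> 2" by simp
    then have "replicate_mset 2 x \<subseteq># A" by (simp add: count_le_replicate_mset_subset_eq)
    then obtain B where "A = replicate_mset 2 x + B" by (auto simp: mset_subset_eq_exists_conv)
    then have "p = [:- x, 1:] * ([:- x, 1:] * smult c (\<Prod>x\<in>#B. [:- x, 1:]))"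
      unfolding pA by (simp add: numeral_2_eq_2)
    moreover have "poly [:- x, 1:] x = 0" by simp
    ultimately obtain u r where "p = u * (u * r)" "poly u x = 0" by blast
    then have "poly p x = 0" "poly (pderiv p) x = 0" by (simp_all add: pderiv_mult)
    with sep show False by blast
  qed
  then have "A = mset_set (set_mset A)"
    by (intro multiset_eqI) (metis One_nat_def count_mset_set(1,3) finite_set_mset le_SucE le_zero_eq not_in_iff)
  then have "size A = card (set_mset A)" by (metis size_mset_set)
  then show ?thesis using A roots by simp
qed

text \<open>Subfields are sets inside one fixed type, since the degree of the extension varies with
  \<open>n\<close>. Closure under \<open>inverse\<close> has no side condition because
  \<open>inverse 0 = 0\<close>.\<close>

locale finite_subfield =
  fixes L :: "'K::field set"
  assumes finite_L: "finite L"
    and one_L: "1 \<in> L"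
    and diff_L: "x \<in> L \<Longrightarrow> y \<in> L \<Longrightarrow> x - y \<in> L"
    and mult_L: "x \<in> L \<Longrightarrow> y \<in> L \<Longrightarrow> x * y \<in> L"
    and inverse_L: "x \<in> L \<Longrightarrow> inverse x \<in> L"
begin

section \<open>Generators of the unit group of a finite field\<close>

lemma zero_L: "0 \<in> L" using diff_L[OF one_L one_L] by simp

lemma add_L: "x \<in> L \<Longrightarrow> y \<in> L \<Longrightarrow> x + y \<in> L"
  using diff_L[of x "0 - y"] diff_L[of 0 y] zero_L by simp

lemma power_L: "x \<in> L \<Longrightarrow> x ^ i \<in> L" for i :: nat
  by (induction i) (auto intro: one_L mult_L)

text \<open>These are the generators of the cyclic group of units, characterized by having the full
  order.\<close>

definition primitive_elements :: "'K set" where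
  "primitive_elements = {x \<in> L - {0}. \<forall>i::nat. x ^ i = 1 \<longleftrightarrow> (card L - 1) dvd i}"

lemma primitive_power_eq_1: "x \<in> primitive_elements \<Longrightarrow> x ^ i = 1 \<longleftrightarrow> (card L - 1) dvd i"
  by (simp add: primitive_elements_def)

text \<open>The first \<open>card L - 1\<close> powers of \<open>x\<close> are distinct, so by
  counting they exhaust the units.\<close>

lemma primitive_generates:
  assumes x: "x \<in> primitive_elements" and y: "y \<in> L" "y \<noteq> 0"
  shows "\<exists>i::nat. y = x ^ i"
proof -
  have x0: "x \<noteq> 0" "x \<in> L" using x by (auto simp: primitive_elements_def)
  have *: "i = j" if "i \<le> j" "j < card L - 1" "x ^ i = x ^ j" for i j :: nat
  proof -
    have "x ^ i * x ^ (j - i) = x ^ j" using that(1) by (simp add: power_add[symmetric])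
    then have "x ^ i * x ^ (j - i) = x ^ i * 1" using that(3) by simp
    then have "x ^ (j - i) = 1" using x0 by simp
    then have "(card L - 1) dvd (j - i)" using primitive_power_eq_1[OF x] by blast
    then show ?thesis using that by (auto dest: dvd_imp_le)
  qed
  have "inj_on (\<lambda>i. x ^ i) {..<card L - 1}"
    by (rule inj_onI) (metis * lessThan_iff nat_le_linear)
  then have "card ((\<lambda>i. x ^ i) ` {..<card L - 1}) = card (L - {0})"
    using finite_L zero_L by (simp add: card_image)
  moreover have "(\<lambda>i. x ^ i) ` {..<card L - 1} \<subseteq> L - {0}" using x0 power_L by auto
  ultimately have "(\<lambda>i. x ^ i) ` {..<card L - 1} = L - {0}"
    using finite_L by (intro card_subset_eq) auto
  then show ?thesis using y by auto
qed

text \<open>\<open>L\<close> is repackaged as a ring record \<open>R\<close>, so that the theorem on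
  the cyclic multiplicative group of a finite field applies.\<close>

lemma card_primitive_elements: "card primitive_elements = totient (card L - 1)"
proof -
  define R :: "'K ring" where "R = \<lparr>carrier = L, monoid.mult = (*), one = 1, ring.zero = 0, add = (+)\<rparr>"
  have minus: "x \<in> L \<Longrightarrow> \<exists>y\<in>L. x + y = 0" for x
    using diff_L[OF zero_L, of x] by (intro bexI[of _ "0 - x"]) auto
  have inv: "x \<in> L \<Longrightarrow> x \<noteq> 0 \<Longrightarrow> \<exists>y\<in>L. x * y = 1" for x
    using inverse_L by (intro bexI[of _ "inverse x"]) auto
  interpret R: field R
    using minus inv unfolding R_def
    by unfold_locales
      (auto simp: algebra_simps Units_def add_L mult_L zero_L one_L)
  have carrier: "carrier R = L" by (simp add: R_def)
  have fin: "finite (carrier R)" using finite_L carrier by simp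
  interpret G: group "mult_of R" by (rule R.field_mult_group)
  have carG: "carrier (mult_of R) = L - {0}" by (simp add: R_def)
  have ordG: "Coset.order (mult_of R) = card L - 1"
    using finite_L zero_L unfolding Coset.order_def carG by simp
  have pow: "x [^]\<^bsub>mult_of R\<^esub> i = x ^ i" for x and i :: nat
    by (induction i) (simp_all add: R_def Multiplicative_Group.nat_pow_mult_of)
  have one: "\<one>\<^bsub>mult_of R\<^esub> = 1" by (simp add: R_def)
  have "{x \<in> carrier (mult_of R). G.ord x = card L - 1} = primitive_elements"
    unfolding primitive_elements_def carG[symmetric]
    using G.ord_unique pow one by fastforce
  \<comment> \<open>The count of elements of a given order requires that one such element exists; a
    generator provides it.\<close>
  moreover have "\<exists>a\<in>carrier (mult_of R). G.ord a = card L - 1"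
  proof -
    obtain a where a: "a \<in> carrier (mult_of R)" "carrier (mult_of R) = {a [^]\<^bsub>R\<^esub> i | i::nat. i \<in> UNIV}"
      using R.finite_field_mult_group_has_gen[OF fin] by blast
    have fG: "finite (carrier (mult_of R))" using finite_L carG by simp
    have "generate (mult_of R) {a} = {a [^]\<^bsub>mult_of R\<^esub> k | k. k \<in> (UNIV :: nat set)}"
      by (rule G.generate_pow_on_finite_carrier[OF fG a(1)])
    also have "\<dots> = carrier (mult_of R)" using a(2) by (simp add: Multiplicative_Group.nat_pow_mult_of)
    finally have "G.ord a = card L - 1"
      using G.generate_pow_card[OF a(1)] ordG by (simp add: Coset.order_def)
    with a(1) show ?thesis by blast
  qed
  ultimately have "card primitive_elements = phi' (card L - 1)"
    using R.num_elems_of_ord_eq_phi'[OF fin, of "card L - 1"] ordG by simp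
  also have "phi' (card L - 1) = totient (card L - 1)"
    unfolding phi'_def totient_def totatives_def by (rule arg_cong[of _ _ card]) auto
  finally show ?thesis .
qed

end

text \<open>The subfield of order \<open>q\<close> consists of the roots of \<open>X^q - X\<close>.
  They form a field because the Frobenius power is additive, and there are exactly \<open>q\<close>
  of them because the derivative is the constant -1.\<close>

lemma finite_subfield_alg_closure:
  fixes q :: nat
  assumes "q = CHAR('k) ^ m" "m > 0"
  defines "L \<equiv> {x :: 'k::{field,finite} alg_closure. x ^ q = x}"
  shows "finite_subfield L" "card L = q"
proof -
  have prime: "prime CHAR('k)" by (rule prime_CHAR_finite_field)
  have q: "q > 1" using one_less_power[of "CHAR('k)" m] prime_gt_1_nat[OF prime] assms by simp
  define p :: "'k alg_closure poly" where "p = monom 1 q - monom 1 1"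
  have deg: "degree p = q"
    using q unfolding p_def 
    by (simp add: degree_add_eq_left degree_monom_eq flip: add_uminus_conv_diff)
  have p0: "p \<noteq> 0" using deg q by auto
  have L: "L = {x. poly p x = 0}" by (auto simp: L_def p_def poly_monom)
  have "of_nat q = (0 :: 'k alg_closure)"
    using assms prime by (auto simp: of_nat_eq_0_iff_char_dvd)
  then have "pderiv p = - 1"
    by (simp add: p_def pderiv_diff pderiv_monom flip: one_pCons monom_0)
  then have "poly (pderiv p) x \<noteq> 0" for x by simp
  then show card: "card L = q" unfolding L deg[symmetric] by (intro card_roots_separable p0)
  have fd: "(x + y) ^ q = x ^ q + y ^ q" for x y :: "'k alg_closure"
    using prime assms by (intro freshmans_dream'[where n = m]) simp_all
  have "(x - y) ^ q = x ^ q - y ^ q" for x y :: "'k alg_closure"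
    using fd[of "x - y" y] by simp
  moreover have "finite L" unfolding L by (rule poly_roots_finite[OF p0])
  ultimately show "finite_subfield L"
    by unfold_locales (auto simp: L_def power_mult_distrib power_inverse)
qed

text \<open>A finite basis is enumerated by indices, so that coordinates become matrix-library
  vectors. The dimension \<open>m\<close> is left open here; it is later identified by comparing
  cardinalities.\<close>

lemma (in vector_space) finite_subspace_coordinates:
  assumes "subspace V" "finite V"
  shows "\<exists>(b :: nat \<Rightarrow> 'b) m. bij_betw (\<lambda>c. \<Sum>i<m. scale (c $ i) (b i)) (carrier_vec m) V"
proof -
  obtain B where B: "B \<subseteq> V" "independent B" "V \<subseteq> span B" by (rule basis_exists[of V])
  have span: "span B = V" using B assms by (simp add: span_eq_iff span_minimal subset_antisym)
  have finB: "finite B" using B assms finite_subset by blast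
  obtain b where b: "bij_betw b {..<card B} B"
    using ex_bij_betw_nat_finite[OF finB] by (auto simp: atLeast0LessThan)
  define m where "m = card B"
  have injb: "inj_on b {..<m}" and imb: "b ` {..<m} = B" using b by (auto simp: bij_betw_def m_def)
  have sum: "(\<Sum>i<m. scale (u (b i)) (b i)) = (\<Sum>v\<in>B. scale (u v) v)" for u
    unfolding imb[symmetric] using injb by (simp add: sum.reindex)
  have inj: "inj_on (\<lambda>c. \<Sum>i<m. scale (c $ i) (b i)) (carrier_vec m)"
  proof (rule inj_onI)
    fix c d :: "'a vec" assume cd: "c \<in> carrier_vec m" "d \<in> carrier_vec m"
      and eq: "(\<Sum>i<m. scale (c $ i) (b i)) = (\<Sum>i<m. scale (d $ i) (b i))"
    \<comment> \<open>Coefficient differences are moved from indices to basis vectors, the form in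
      which independence applies.\<close>
    define u where "u v = (let i = the_inv_into {..<m} b v in c $ i - d $ i)" for v
    have u: "u (b i) = c $ i - d $ i" if "i < m" for i
      using that injb by (simp add: u_def the_inv_into_f_f)
    have "(\<Sum>v\<in>B. scale (u v) v) = (\<Sum>i<m. scale (c $ i - d $ i) (b i))"
      unfolding sum[symmetric] by (rule sum.cong) (simp_all add: u)
    also have "\<dots> = 0" using eq by (simp add: scale_left_diff_distrib sum_subtractf)
    finally have "u v = 0" if "v \<in> B" for v
      using that B(2) finB independentD[of B B u v] by blast
    then have "c $ i = d $ i" if "i < m" for i using that u[of i] imb by force
    then show "c = d" using cd by (intro eq_vecI) auto
  qed
  have "(\<lambda>c. \<Sum>i<m. scale (c $ i) (b i)) ` carrier_vec m = V"
  proof (intro equalityI subsetI)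
    fix x assume "x \<in> V"
    then have "x \<in> range (\<lambda>u. \<Sum>v\<in>B. scale (u v) v)" using span_finite[OF finB] span by simp
    then obtain u where "x = (\<Sum>v\<in>B. scale (u v) v)" by blast
    then have "x = (\<Sum>i<m. scale (vec m (\<lambda>i. u (b i)) $ i) (b i))"
      unfolding sum[symmetric] by simp
    then show "x \<in> (\<lambda>c. \<Sum>i<m. scale (c $ i) (b i)) ` carrier_vec m"
      by (intro image_eqI[of _ _ "vec m (\<lambda>i. u (b i))"]) simp_all
  next
    fix x assume "x \<in> (\<lambda>c. \<Sum>i<m. scale (c $ i) (b i)) ` carrier_vec m"
    then show "x \<in> V"
      using B(1) imb assms(1) by (auto intro!: subspace_sum subspace_scale)
  qed
  with inj show ?thesis unfolding bij_betw_def by blast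
qed

section \<open>Counting conjugates\<close>

text \<open>The equation \<open>g t = y g\<close> expresses conjugacy without inverses and passes to
  all powers of \<open>t\<close> and \<open>y\<close>.\<close>

lemma (in group) ord_conjugate:
  assumes "g \<in> carrier G" "t \<in> carrier G" "y \<in> carrier G" "g \<otimes> t = y \<otimes> g"
  shows "ord y = ord t"
proof -
  have pow: "g \<otimes> t [^] k = y [^] k \<otimes> g" for k :: nat
  proof (induction k)
    case (Suc k)
    have "g \<otimes> t [^] Suc k = (y [^] k \<otimes> g) \<otimes> t"
      using assms Suc by (simp add: m_assoc[symmetric])
    also have "\<dots> = y [^] k \<otimes> (y \<otimes> g)" using assms by (simp add: m_assoc)
    finally show ?case using assms by (simp add: m_assoc)
  qed (use assms in simp)
  have "y [^] k = \<one> \<longleftrightarrow> ord t dvd k" for k :: nat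
  proof -
    have "y [^] k = \<one> \<longleftrightarrow> y [^] k \<otimes> g = \<one> \<otimes> g" using assms by (simp del: l_one)
    also have "\<dots> \<longleftrightarrow> g \<otimes> t [^] k = g \<otimes> \<one>" using assms pow[of k] by simp
    also have "\<dots> \<longleftrightarrow> t [^] k = \<one>" using assms by (simp del: r_one)
    finally show ?thesis using pow_eq_id assms by simp
  qed
  then show ?thesis using ord_unique assms by blast
qed

text \<open>Double counting of the pairs \<open>(g, t)\<close> by the conjugate \<open>g t g\<^sup>-\<^sup>1\<close>; the hypothesis on
  \<open>c\<close> bounds both the centralizers and the sets of elements conjugating \<open>t\<close> to a given \<open>y\<close>.\<close>

lemma average_order_ge_conjugates:
  fixes G (structure)
  assumes "group G" "finite (carrier G)" and T: "T \<subseteq> carrier G"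
    and N: "\<And>t. t \<in> T \<Longrightarrow> group.ord G t = N"
    and c: "\<And>t y. t \<in> T \<Longrightarrow> y \<in> carrier G \<Longrightarrow> card {g \<in> carrier G. g \<otimes> t = y \<otimes> g} \<le> c"
    and m: "\<And>y. y \<in> carrier G \<Longrightarrow> card {t \<in> T. \<exists>g\<in>carrier G. g \<otimes> t = y \<otimes> g} \<le> m"
  shows "real (N * card T) \<le> average_order G * real (m * c)"
proof -
  interpret group G by fact
  have finT: "finite T" using T assms(2) finite_subset by blast
  define Y where "Y = {y \<in> carrier G. \<exists>t\<in>T. \<exists>g\<in>carrier G. g \<otimes> t = y \<otimes> g}"
  \<comment> \<open>For \<open>y\<close> in the group, \<open>S y\<close> holds the pairs
    \<open>(t, g)\<close> in which \<open>g\<close> conjugates \<open>t\<close> to \<open>y\<close>: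
    at most \<open>m\<close> choices of \<open>t\<close> and, for each, at most \<open>c\<close> of
    \<open>g\<close>.\<close>
  define S where "S y = (SIGMA t:{t \<in> T. \<exists>g\<in>carrier G. g \<otimes> t = y \<otimes> g}. {g \<in> carrier G. g \<otimes> t = y \<otimes> g})" for y
  have finY: "finite Y" using assms(2) by (auto simp: Y_def)
  have card_S: "card (S y) \<le> m * c" if y: "y \<in> carrier G" for y
  proof -
    have "card (S y) = (\<Sum>t\<in>{t \<in> T. \<exists>g\<in>carrier G. g \<otimes> t = y \<otimes> g}. card {g \<in> carrier G. g \<otimes> t = y \<otimes> g})"
      unfolding S_def using finT assms(2) by (subst card_SigmaI) auto
    also have "\<dots> \<le> card {t \<in> T. \<exists>g\<in>carrier G. g \<otimes> t = y \<otimes> g} * c"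
      using c y by (intro order_trans[OF sum_bounded_above]) auto
    also have "\<dots> \<le> m * c" using m y by simp
    finally show ?thesis .
  qed
  have "T \<times> carrier G \<subseteq> (\<Union>y\<in>Y. S y)"
  proof safe
    fix t g assume tg: "t \<in> T" "g \<in> carrier G"
    then have "t \<in> carrier G" using T by blast
    then have "g \<otimes> t \<otimes> inv g \<in> carrier G" "g \<otimes> t = (g \<otimes> t \<otimes> inv g) \<otimes> g"
      using tg by (simp_all add: m_assoc)
    with tg show "(t, g) \<in> (\<Union>y\<in>Y. S y)" by (auto simp: Y_def S_def)
  qed
  moreover have "finite (\<Union>y\<in>Y. S y)" using finY finT assms(2) by (auto simp: S_def)
  ultimately have "card (T \<times> carrier G) \<le> card (\<Union>y\<in>Y. S y)" by (intro card_mono)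
  also have "\<dots> \<le> (\<Sum>y\<in>Y. card (S y))" by (rule card_UN_le[OF finY])
  also have "\<dots> \<le> card Y * (m * c)"
    using card_S by (intro order_trans[OF sum_bounded_above]) (auto simp: Y_def)
  finally have 1: "card T * card (carrier G) \<le> card Y * (m * c)" by (simp add: card_cartesian_product)
  \<comment> \<open>All members of \<open>Y\<close> have order \<open>N\<close> and the remaining
    orders are nonnegative, so \<open>card Y * N\<close> bounds the sum of all orders from
    below.\<close>
  have "ord y = N" if "y \<in> Y" for y
    using that ord_conjugate N T unfolding Y_def by blast
  then have "real (card Y * N) = (\<Sum>y\<in>Y. real (ord y))" by simp
  also have "\<dots> \<le> (\<Sum>y\<in>carrier G. real (ord y))"
    using assms(2) by (intro sum_mono2) (auto simp: Y_def)
  also have "\<dots> = average_order G * real (card (carrier G))"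
    using assms(2) one_closed by (auto simp: average_order_def card_eq_0_iff)
  finally have 2: "real (card Y * N) \<le> average_order G * real (card (carrier G))" .
  have "real (N * card T) * real (card (carrier G)) = real N * real (card T * card (carrier G))" by simp
  also have "\<dots> \<le> real N * real (card Y * (m * c))" using 1 by (intro mult_left_mono of_nat_mono) auto
  also have "\<dots> = real (card Y * N) * real (m * c)" by simp
  also have "\<dots> \<le> average_order G * real (card (carrier G)) * real (m * c)"
    using 2 by (intro mult_right_mono) auto
  finally have "real (N * card T) * real (card (carrier G)) \<le>
      (average_order G * real (m * c)) * real (card (carrier G))" by (simp add: mult_ac)
  moreover have "card (carrier G) > 0" using assms(2) one_closed by (auto simp: card_gt_0_iff)
  ultimately show ?thesis by simp
qed

section \<open>Matrices of multiplication maps\<close>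

lemma carrier_vec_eqI:
  fixes v w :: "'a::comm_semiring_1 vec"
  assumes "v \<in> carrier_vec n" "w \<in> carrier_vec n"
    and "\<And>u. u \<in> carrier_vec n \<Longrightarrow> u \<bullet> v = u \<bullet> w"
  shows "v = w"
proof (rule eq_vecI)
  fix i assume "i < dim_vec w"
  then show "v $ i = w $ i" using assms(3)[of "unit_vec n i"] assms(1,2) by simp
qed (use assms in auto)

lemma carrier_mat_eqI:
  fixes A B :: "'a::comm_semiring_1 mat"
  assumes "A \<in> carrier_mat m n" "B \<in> carrier_mat m n"
    and "\<And>v. v \<in> carrier_vec n \<Longrightarrow> A *\<^sub>v v = B *\<^sub>v v"
  shows "A = B"
proof (rule eq_matI)
  fix i j assume ij: "i < dim_row B" "j < dim_col B"
  have "(A *\<^sub>v unit_vec n j) $ i = (B *\<^sub>v unit_vec n j) $ i" using assms(3) by simp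
  then show "A $$ (i, j) = B $$ (i, j)"
    using ij assms(1,2) by (simp add: scalar_prod_right_unit)
qed (use assms in auto)

lemma card_carrier_vec:
  "finite (carrier_vec n :: 'a::finite vec set)"
  "card (carrier_vec n :: 'a::finite vec set) = card (UNIV :: 'a set) ^ n"
proof -
  have "bij_betw (vec_of_list :: 'a list \<Rightarrow> 'a vec) {xs. set xs \<subseteq> UNIV \<and> length xs = n} (carrier_vec n)"
    by (rule bij_betw_byWitness[of _ list_of_vec]) (auto simp: vec_list list_vec intro!: carrier_vecI)
  from bij_betw_finite[OF this] bij_betw_same_card[OF this]
  show "finite (carrier_vec n :: 'a vec set)"
    "card (carrier_vec n :: 'a vec set) = card (UNIV :: 'a set) ^ n"
    using finite_lists_length_eq[of "UNIV :: 'a set" n] card_lists_length_eq[of "UNIV :: 'a set" n]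
    by simp_all
qed

lemma finite_carrier_mat: "finite (carrier_mat m n :: 'a::finite mat set)"
proof (rule finite_subset)
  let ?F = "({..<m} \<times> {..<n}) \<rightarrow>\<^sub>E (UNIV :: 'a set)"
  show "carrier_mat m n \<subseteq> mat m n ` ?F"
  proof
    fix A :: "'a mat" assume A: "A \<in> carrier_mat m n"
    show "A \<in> mat m n ` ?F"
    proof (rule image_eqI[where x = "restrict (\<lambda>ij. A $$ ij) ({..<m} \<times> {..<n})"])
      show "A = mat m n (restrict (\<lambda>ij. A $$ ij) ({..<m} \<times> {..<n}))" using A by (intro eq_matI) auto
    qed simp
  qed
  show "finite (mat m n ` ?F)" by (intro finite_imageI finite_PiE) auto
qed

text \<open>The basis \<open>b\<close> of \<open>L\<close> over the base field enters through a
  bijective coordinate map, which also determines the cardinality of \<open>L\<close>.\<close>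

locale finite_extension = finite_subfield L + comm_ring_hom hom
  for L :: "'K::field set" and hom :: "'k::{field,finite} \<Rightarrow> 'K" +
  fixes l :: nat and b :: "nat \<Rightarrow> 'K"
  assumes bij_coordinates: "bij_betw (\<lambda>c. \<Sum>i<l. hom (c $ i) * b i) (carrier_vec l) L"
begin

section \<open>Coordinates and the regular representation\<close>

definition elem :: "'k vec \<Rightarrow> 'K" where
  "elem c = (\<Sum>i<l. hom (c $ i) * b i)"

definition coords :: "'K \<Rightarrow> 'k vec" where
  "coords = the_inv_into (carrier_vec l) elem"

lemma bij_elem: "bij_betw elem (carrier_vec l) L"
  using bij_coordinates by (simp add: elem_def[abs_def])

lemma coords_carrier: "x \<in> L \<Longrightarrow> coords x \<in> carrier_vec l"
  using bij_betw_the_inv_into[OF bij_elem] by (auto simp: coords_def bij_betw_def)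

lemma elem_coords: "x \<in> L \<Longrightarrow> elem (coords x) = x"
  unfolding coords_def using bij_elem by (intro f_the_inv_into_f_bij_betw) auto

lemma elem_L: "c \<in> carrier_vec l \<Longrightarrow> elem c \<in> L"
  using bij_elem by (auto simp: bij_betw_def)

lemma elem_inject: "c \<in> carrier_vec l \<Longrightarrow> d \<in> carrier_vec l \<Longrightarrow> elem c = elem d \<longleftrightarrow> c = d"
  using bij_elem by (auto simp: bij_betw_def inj_on_def)

lemma card_L: "card L = card (UNIV :: 'k set) ^ l"
  using bij_betw_same_card[OF bij_elem] card_carrier_vec(2)[where 'a = 'k] by simp

lemma elem_add: "c \<in> carrier_vec l \<Longrightarrow> d \<in> carrier_vec l \<Longrightarrow> elem (c + d) = elem c + elem d"
  by (simp add: elem_def hom_add distrib_right sum.distrib)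

lemma elem_zero: "elem (0\<^sub>v l) = 0"
  by (simp add: elem_def)

lemma elem_unit_vec: "j < l \<Longrightarrow> elem (unit_vec l j) = b j"
proof -
  assume j: "j < l"
  have "elem (unit_vec l j) = (\<Sum>i<l. if i = j then b i else 0)"
    unfolding elem_def by (rule sum.cong) (use j in auto)
  then show ?thesis using j by simp
qed

lemma b_L: "j < l \<Longrightarrow> b j \<in> L"
  using elem_L[of "unit_vec l j"] elem_unit_vec by simp

text \<open>On \<open>L\<close> this is the regular representation over the base field in the basis
  \<open>b\<close>.\<close>

definition mult_mat :: "'K \<Rightarrow> 'k mat" where
  "mult_mat x = mat l l (\<lambda>(i, j). coords (x * b j) $ i)"

lemma mult_mat_carrier: "mult_mat x \<in> carrier_mat l l"
  by (simp add: mult_mat_def)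

lemma sum_mult_mat:
  assumes "x \<in> L" "j < l"
  shows "(\<Sum>i<l. hom (mult_mat x $$ (i, j)) * b i) = x * b j"
proof -
  have "(\<Sum>i<l. hom (mult_mat x $$ (i, j)) * b i) = elem (coords (x * b j))"
    unfolding elem_def mult_mat_def using assms by (intro sum.cong) simp_all
  then show ?thesis using assms by (simp add: elem_coords mult_L b_L)
qed

text \<open>By linearity the basis vectors suffice, where \<open>sum_mult_mat\<close> applies after
  swapping the sums. This intertwining turns identities of matrices into identities in
  \<open>L\<close>.\<close>

lemma elem_mult_mat:
  assumes "x \<in> L" "c \<in> carrier_vec l"
  shows "elem (mult_mat x *\<^sub>v c) = x * elem c"
proof -
  have "elem (mult_mat x *\<^sub>v c) = (\<Sum>i<l. \<Sum>j<l. hom (mult_mat x $$ (i, j)) * b i * hom (c $ j))"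
    unfolding elem_def using assms mult_mat_carrier[of x]
    by (intro sum.cong refl)
      (simp add: scalar_prod_def hom_sum hom_mult sum_distrib_left atLeast0LessThan mult_ac)
  also have "\<dots> = (\<Sum>j<l. (\<Sum>i<l. hom (mult_mat x $$ (i, j)) * b i) * hom (c $ j))"
    by (subst sum.swap) (simp add: sum_distrib_right)
  also have "\<dots> = x * elem c"
    unfolding elem_def sum_distrib_left using assms by (intro sum.cong) (simp_all add: sum_mult_mat)
  finally show ?thesis .
qed

lemma mult_mat_eqI:
  assumes "x \<in> L" "c \<in> carrier_vec l" "d \<in> carrier_vec l" "elem d = x * elem c"
  shows "mult_mat x *\<^sub>v c = d"
  using assms elem_mult_mat mult_mat_carrier
  by (metis elem_inject mult_mat_vec_carrier)

lemma mult_mat_mult: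
  assumes "x \<in> L" "y \<in> L"
  shows "mult_mat (x * y) = mult_mat x * mult_mat y"
proof (rule carrier_mat_eqI[of _ l l])
  fix v :: "'k vec" assume v: "v \<in> carrier_vec l"
  have c: "mult_mat z *\<^sub>v w \<in> carrier_vec l" if "w \<in> carrier_vec l" for z w
    using that mult_mat_carrier by (rule_tac mult_mat_vec_carrier)
  show "mult_mat (x * y) *\<^sub>v v = (mult_mat x * mult_mat y) *\<^sub>v v"
    using assms v c mult_mat_carrier
    by (intro mult_mat_eqI) (auto simp: assoc_mult_mat_vec[of _ l l _ l] elem_mult_mat mult_L)
qed (simp_all add: mult_mat_carrier mult_carrier_mat[of _ l l])

lemma mult_mat_add:
  assumes "x \<in> L" "y \<in> L"
  shows "mult_mat (x + y) = mult_mat x + mult_mat y"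
proof (rule carrier_mat_eqI[of _ l l])
  fix v :: "'k vec" assume v: "v \<in> carrier_vec l"
  have c: "mult_mat z *\<^sub>v w \<in> carrier_vec l" if "w \<in> carrier_vec l" for z w
    using that mult_mat_carrier by (rule_tac mult_mat_vec_carrier)
  show "mult_mat (x + y) *\<^sub>v v = (mult_mat x + mult_mat y) *\<^sub>v v"
    using assms v c mult_mat_carrier
    by (intro mult_mat_eqI)
      (auto simp: add_mult_distrib_mat_vec[of _ l l] elem_mult_mat elem_add add_L distrib_right)
qed (use mult_mat_carrier in auto)

lemma mult_mat_one: "mult_mat 1 = 1\<^sub>m l"
  by (rule carrier_mat_eqI[of _ l l]) (auto simp: mult_mat_carrier intro!: mult_mat_eqI one_L)

lemma mult_mat_inverse:
  assumes "x \<in> L" "x \<noteq> 0"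
  shows "mult_mat x * mult_mat (inverse x) = 1\<^sub>m l" "mult_mat (inverse x) * mult_mat x = 1\<^sub>m l"
  using assms by (simp_all add: mult_mat_mult[symmetric] inverse_L mult_mat_one)

text \<open>So \<open>coords 1\<close> is a cyclic vector: whatever commutes with all multiplication
  matrices is determined by its value there.\<close>

lemma mult_mat_coords_one:
  "c \<in> carrier_vec l \<Longrightarrow> mult_mat (elem c) *\<^sub>v coords 1 = c"
  by (intro mult_mat_eqI) (auto simp: elem_L coords_carrier elem_coords one_L)

text \<open>Read by columns, the defining relation \<open>sum_mult_mat\<close> says that the vector
  of basis elements is an eigenvector of the transpose, with eigenvalue \<open>x\<close>
  itself.\<close>

lemma eigenvector_mult_mat:
  assumes "x \<in> L"
  shows "transpose_mat (map_mat hom (mult_mat x)) *\<^sub>v vec l b = x \<cdot>\<^sub>v vec l b"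
proof (rule eq_vecI)
  fix j assume "j < dim_vec (x \<cdot>\<^sub>v vec l b)"
  then have j: "j < l" by simp
  then show "(transpose_mat (map_mat hom (mult_mat x)) *\<^sub>v vec l b) $ j = (x \<cdot>\<^sub>v vec l b) $ j"
    using sum_mult_mat[OF assms j] mult_mat_carrier[of x]
    by (simp add: scalar_prod_def atLeast0LessThan)
qed (use mult_mat_carrier[of x] in auto)

end

section \<open>A torus in the orthogonal group\<close>

text \<open>Both parities are treated at once: the unit block has size \<open>s = n mod 2\<close>
  and may be empty.\<close>

definition split_form :: "nat \<Rightarrow> nat \<Rightarrow> 'k::field mat" where
  "split_form s l = four_block_mat (1\<^sub>m s) (0\<^sub>m s (l + l)) (0\<^sub>m (l + l) s) (hyperbolic_mat l)"

lemma O_plus_form_eq_split_form: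
  "(O_plus_form n :: 'a::field mat) = split_form (n mod 2) (n div 2)"
proof (cases "odd n")
  case True
  then have [simp]: "n mod 2 = 1" by presburger
  define H where "H = (hyperbolic_mat (n div 2) :: 'a mat)"
  have dims: "dim_row H = n div 2 + n div 2" "dim_col H = n div 2 + n div 2"
    by (simp_all add: H_def hyperbolic_mat_def)
  \<comment> \<open>\<open>diag_block_mat\<close> ends its list with an empty block, which has to be
    absorbed.\<close>
  moreover have "four_block_mat H (0\<^sub>m (dim_row H) 0) (0\<^sub>m 0 (dim_col H)) (0\<^sub>m 0 0) = H"
    by (intro eq_matI) auto
  ultimately show ?thesis using True by (simp add: O_plus_form_def split_form_def Let_def H_def)
next
  case False
  then have "n mod 2 = 0" by presburger
  moreover have "hyperbolic_mat (n div 2) \<in> carrier_mat (n div 2 + n div 2) (n div 2 + n div 2)"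
    by (simp add: hyperbolic_mat_def)
  ultimately show ?thesis
    using False unfolding O_plus_form_def split_form_def by (intro eq_matI) auto
qed

text \<open>In block coordinates the two blocks of size \<open>l\<close> are totally isotropic and
  dual to each other; the later proofs use the form only through this formula.\<close>

lemma bilinear_form_split_form:
  fixes u u' v v' w w' :: "'k::field vec"
  assumes "u \<in> carrier_vec s" "u' \<in> carrier_vec s"
    "v \<in> carrier_vec l" "v' \<in> carrier_vec l" "w \<in> carrier_vec l" "w' \<in> carrier_vec l"
  shows "bilinear_form (split_form s l) (u @\<^sub>v v @\<^sub>v w) (u' @\<^sub>v v' @\<^sub>v w') =
    u \<bullet> u' + v \<bullet> w' + w \<bullet> v'"
proof -
  have H: "hyperbolic_mat l \<in> carrier_mat (l + l) (l + l)" by (simp add: hyperbolic_mat_def)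
  have "hyperbolic_mat l *\<^sub>v (v' @\<^sub>v w') = w' @\<^sub>v v'"
    unfolding hyperbolic_mat_def
    using assms by (subst four_block_mat_mult_vec[of _ l l _ l _ l]) auto
  then have "split_form s l *\<^sub>v (u' @\<^sub>v v' @\<^sub>v w') = u' @\<^sub>v w' @\<^sub>v v'"
    unfolding split_form_def using assms H
    by (subst mult_mat_vec_split[where n = s and m = "l + l"]) auto
  then show ?thesis
    unfolding bilinear_form_def using assms
    by (simp add: scalar_prod_append[of _ s _ "l + l"] scalar_prod_append[of _ l _ l])
qed

section \<open>Vectors and matrices in three blocks\<close>

lemma block_vec_cases:
  fixes x :: "'a vec"
  assumes "x \<in> carrier_vec (s + (l + l))"
  obtains u v w where "u \<in> carrier_vec s" "v \<in> carrier_vec l" "w \<in> carrier_vec l" "x = u @\<^sub>v v @\<^sub>v w"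
proof -
  define y where "y = vec_last x (l + l)"
  have y: "y \<in> carrier_vec (l + l)" by (simp add: y_def)
  have "x = vec_first x s @\<^sub>v vec_first y l @\<^sub>v vec_last y l"
    using assms y by (simp add: y_def)
  then show ?thesis by (intro that) auto
qed

lemma block_vec_eq_iff:
  assumes "u \<in> carrier_vec s" "u' \<in> carrier_vec s" "v \<in> carrier_vec l" "v' \<in> carrier_vec l"
  shows "u @\<^sub>v v @\<^sub>v w = u' @\<^sub>v v' @\<^sub>v w' \<longleftrightarrow> u = u' \<and> v = v' \<and> w = w'"
  using assms by (simp add: append_vec_eq[of u s] append_vec_eq[of v l])

lemma block_vec_add:
  assumes "u \<in> carrier_vec s" "u' \<in> carrier_vec s" "v \<in> carrier_vec l" "v' \<in> carrier_vec l"
    "w \<in> carrier_vec l" "w' \<in> carrier_vec l"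
  shows "(u @\<^sub>v v @\<^sub>v w) + (u' @\<^sub>v v' @\<^sub>v w') = (u + u') @\<^sub>v (v + v') @\<^sub>v (w + w')"
  using assms by (simp add: append_vec_add[of _ s _ _ "l + l"] append_vec_add[of _ l _ _ l])

lemma block_mat_eqI:
  fixes A B :: "'a::comm_ring_1 mat"
  assumes "A \<in> carrier_mat m (s + (l + l))" "B \<in> carrier_mat m (s + (l + l))"
    and u: "\<And>u. u \<in> carrier_vec s \<Longrightarrow> A *\<^sub>v (u @\<^sub>v 0\<^sub>v l @\<^sub>v 0\<^sub>v l) = B *\<^sub>v (u @\<^sub>v 0\<^sub>v l @\<^sub>v 0\<^sub>v l)"
    and v: "\<And>v. v \<in> carrier_vec l \<Longrightarrow> A *\<^sub>v (0\<^sub>v s @\<^sub>v v @\<^sub>v 0\<^sub>v l) = B *\<^sub>v (0\<^sub>v s @\<^sub>v v @\<^sub>v 0\<^sub>v l)"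
    and w: "\<And>w. w \<in> carrier_vec l \<Longrightarrow> A *\<^sub>v (0\<^sub>v s @\<^sub>v 0\<^sub>v l @\<^sub>v w) = B *\<^sub>v (0\<^sub>v s @\<^sub>v 0\<^sub>v l @\<^sub>v w)"
  shows "A = B"
proof (rule carrier_mat_eqI[OF assms(1,2)])
  fix x :: "'a vec" assume "x \<in> carrier_vec (s + (l + l))"
  then obtain u v w where x: "u \<in> carrier_vec s" "v \<in> carrier_vec l" "w \<in> carrier_vec l"
    "x = u @\<^sub>v v @\<^sub>v w" by (rule block_vec_cases)
  define xv where "xv = u @\<^sub>v 0\<^sub>v l @\<^sub>v 0\<^sub>v l"
  define yv where "yv = 0\<^sub>v s @\<^sub>v v @\<^sub>v 0\<^sub>v l"
  define zv where "zv = 0\<^sub>v s @\<^sub>v 0\<^sub>v l @\<^sub>v w"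
  have xyz: "xv \<in> carrier_vec (s + (l + l))" "yv \<in> carrier_vec (s + (l + l))" "zv \<in> carrier_vec (s + (l + l))"
    using x by (auto simp: xv_def yv_def zv_def)
  have "x = (xv + yv) + zv"
    using x by (simp add: xv_def yv_def zv_def block_vec_add[of _ s _ _ l])
  then show "A *\<^sub>v x = B *\<^sub>v x"
    using u[OF x(1)] v[OF x(2)] w[OF x(3)] xyz assms(1,2)
    by (simp add: mult_add_distrib_mat_vec[of _ m "s + (l + l)"] xv_def[symmetric] yv_def[symmetric] zv_def[symmetric])
qed

context finite_extension
begin

text \<open>Duality of the isotropic blocks forces the inverse transpose on the second one.\<close>

definition torus_mat :: "nat \<Rightarrow> 'K \<Rightarrow> 'k mat" where
  "torus_mat s x = four_block_mat (1\<^sub>m s) (0\<^sub>m s (l + l)) (0\<^sub>m (l + l) s)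
     (four_block_mat (mult_mat x) (0\<^sub>m l l) (0\<^sub>m l l) (transpose_mat (mult_mat (inverse x))))"

lemma torus_mat_carrier: "torus_mat s x \<in> carrier_mat (s + (l + l)) (s + (l + l))"
  using mult_mat_carrier by (auto simp: torus_mat_def intro!: four_block_carrier_mat)

lemma mult_mat_vec_closed [simp]:
  "c \<in> carrier_vec l \<Longrightarrow> mult_mat x *\<^sub>v c \<in> carrier_vec l"
  "c \<in> carrier_vec l \<Longrightarrow> transpose_mat (mult_mat x) *\<^sub>v c \<in> carrier_vec l"
  using mult_mat_carrier[of x] by (auto intro!: mult_mat_vec_carrier[of _ l l])

lemma torus_mat_mult_vec:
  assumes "u \<in> carrier_vec s" "v \<in> carrier_vec l" "w \<in> carrier_vec l"
  shows "torus_mat s x *\<^sub>v (u @\<^sub>v v @\<^sub>v w) =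
    u @\<^sub>v (mult_mat x *\<^sub>v v) @\<^sub>v (transpose_mat (mult_mat (inverse x)) *\<^sub>v w)"
proof -
  have T: "transpose_mat (mult_mat (inverse x)) \<in> carrier_mat l l" by (simp add: mult_mat_carrier)
  have "four_block_mat (mult_mat x) (0\<^sub>m l l) (0\<^sub>m l l) (transpose_mat (mult_mat (inverse x))) *\<^sub>v (v @\<^sub>v w) =
      (mult_mat x *\<^sub>v v) @\<^sub>v (transpose_mat (mult_mat (inverse x)) *\<^sub>v w)"
    by (rule mult_mat_vec_split[OF mult_mat_carrier T assms(2,3)])
  moreover have "four_block_mat (mult_mat x) (0\<^sub>m l l) (0\<^sub>m l l) (transpose_mat (mult_mat (inverse x)))
      \<in> carrier_mat (l + l) (l + l)"
    by (rule four_block_carrier_mat[OF mult_mat_carrier T])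
  ultimately show ?thesis
    unfolding torus_mat_def using assms
    by (subst mult_mat_vec_split[where n = s and m = "l + l"]) auto
qed

lemma torus_mat_mult:
  assumes "x \<in> L" "y \<in> L"
  shows "torus_mat s x * torus_mat s y = torus_mat s (x * y)"
proof (rule carrier_mat_eqI[of _ "s + (l + l)" "s + (l + l)"])
  fix z :: "'k vec" assume z: "z \<in> carrier_vec (s + (l + l))"
  then obtain u v w where uvw: "u \<in> carrier_vec s" "v \<in> carrier_vec l" "w \<in> carrier_vec l"
    "z = u @\<^sub>v v @\<^sub>v w" by (rule block_vec_cases)
  \<comment> \<open>The factors are reversed, using commutativity of \<open>L\<close>, because
    transposition reverses them back.\<close>
  have inv: "mult_mat (inverse x * inverse y) = mult_mat (inverse y) * mult_mat (inverse x)"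
    using assms mult_mat_mult[of "inverse y" "inverse x"] by (simp add: inverse_L mult.commute)
  show "(torus_mat s x * torus_mat s y) *\<^sub>v z = torus_mat s (x * y) *\<^sub>v z"
    using uvw assms mult_mat_carrier
    by (simp add: assoc_mult_mat_vec[OF torus_mat_carrier torus_mat_carrier] z[unfolded uvw(4)]
        torus_mat_mult_vec inv transpose_mult[of _ l l _ l] mult_mat_mult
        assoc_mult_mat_vec[of _ l l _ l])
qed (simp_all add: torus_mat_carrier mult_carrier_mat[OF torus_mat_carrier torus_mat_carrier])

lemma torus_mat_one: "torus_mat s 1 = 1\<^sub>m (s + (l + l))"
proof (rule carrier_mat_eqI[of _ "s + (l + l)" "s + (l + l)"])
  fix z :: "'k vec" assume z: "z \<in> carrier_vec (s + (l + l))"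
  then obtain u v w where uvw: "u \<in> carrier_vec s" "v \<in> carrier_vec l" "w \<in> carrier_vec l"
    "z = u @\<^sub>v v @\<^sub>v w" by (rule block_vec_cases)
  then show "torus_mat s 1 *\<^sub>v z = 1\<^sub>m (s + (l + l)) *\<^sub>v z"
    using z by (simp add: torus_mat_mult_vec mult_mat_one)
qed (simp_all add: torus_mat_carrier)

text \<open>Evaluating on \<open>coords 1\<close> in the first isotropic block gives
  \<open>x * 1 = 1\<close>.\<close>

lemma torus_mat_eq_one_iff:
  assumes "x \<in> L"
  shows "torus_mat s x = 1\<^sub>m (s + (l + l)) \<longleftrightarrow> x = 1"
proof
  assume "torus_mat s x = 1\<^sub>m (s + (l + l))"
  then have "torus_mat s x *\<^sub>v (0\<^sub>v s @\<^sub>v coords 1 @\<^sub>v 0\<^sub>v l) = 0\<^sub>v s @\<^sub>v coords 1 @\<^sub>v 0\<^sub>v l"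
    using coords_carrier[OF one_L] by (subst (asm) (1) HOL.refl) simp
  then have "mult_mat x *\<^sub>v coords 1 = coords 1"
    using coords_carrier[OF one_L] by (simp add: torus_mat_mult_vec block_vec_eq_iff[of _ s _ _ l])
  then show "x = 1"
    using elem_mult_mat[OF assms coords_carrier[OF one_L]] elem_coords[OF one_L] by simp
qed (simp add: torus_mat_one)

text \<open>The inverse transpose cancels the matrix in the dot product of the two isotropic blocks,
  and the unit block is fixed.\<close>

lemma torus_mat_isometry:
  assumes "x \<in> L" "x \<noteq> 0"
  shows "torus_mat s x \<in> isometries (s + (l + l)) (split_form s l)"
proof -
  have "torus_mat s x * torus_mat s (inverse x) = 1\<^sub>m (s + (l + l))"
    "torus_mat s (inverse x) * torus_mat s x = 1\<^sub>m (s + (l + l))"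
    using assms by (simp_all add: torus_mat_mult inverse_L torus_mat_one)
  then have "torus_mat s x \<in> carrier (GL TYPE('k) (s + (l + l)))"
    using torus_mat_carrier by (auto simp: carrier_GL)
  moreover have "bilinear_form (split_form s l) (torus_mat s x *\<^sub>v y) (torus_mat s x *\<^sub>v z) =
      bilinear_form (split_form s l) y z"
    if y: "y \<in> carrier_vec (s + (l + l))" and z: "z \<in> carrier_vec (s + (l + l))" for y z
  proof -
    obtain u v w where 1: "u \<in> carrier_vec s" "v \<in> carrier_vec l" "w \<in> carrier_vec l"
      "y = u @\<^sub>v v @\<^sub>v w" using y by (rule block_vec_cases)
    obtain u' v' w' where 2: "u' \<in> carrier_vec s" "v' \<in> carrier_vec l" "w' \<in> carrier_vec l"
      "z = u' @\<^sub>v v' @\<^sub>v w'" using z by (rule block_vec_cases)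
    have *: "(transpose_mat (mult_mat (inverse x)) *\<^sub>v c) \<bullet> (mult_mat x *\<^sub>v d) = c \<bullet> d"
      if "c \<in> carrier_vec l" "d \<in> carrier_vec l" for c d
      using that mult_mat_carrier mult_mat_inverse[OF assms]
      by (simp add: transpose_vec_mult_scalar[of _ l l] assoc_mult_mat_vec[of _ l l _ l, symmetric])
    have "(mult_mat x *\<^sub>v v) \<bullet> (transpose_mat (mult_mat (inverse x)) *\<^sub>v w') = v \<bullet> w'"
      using *[of w' v] 1 2 by (simp add: comm_scalar_prod[of _ l])
    then show ?thesis
      using 1 2 *[of w v'] by (simp add: torus_mat_mult_vec bilinear_form_split_form)
  qed
  ultimately show ?thesis by (simp add: isometries_def)
qed

text \<open>The vector of basis elements, padded by zeros, is an eigenvector of the transpose, which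
  has the same characteristic polynomial. Hence a conjugacy class determines \<open>x\<close> up to
  at most \<open>n\<close> choices.\<close>

lemma torus_mat_eigenvalue:
  assumes "x \<in> L" "x \<noteq> 0"
  shows "poly (map_poly hom (char_poly (torus_mat s x))) x = 0"
proof -
  let ?n = "s + (l + l)"
  define A where "A = map_mat hom (torus_mat s x)"
  define c where "c = 0\<^sub>v s @\<^sub>v vec l b @\<^sub>v 0\<^sub>v l"
  have A: "A \<in> carrier_mat ?n ?n" using torus_mat_carrier by (simp add: A_def)
  have M: "map_mat hom (mult_mat x) \<in> carrier_mat l l" "map_mat hom (transpose_mat (mult_mat (inverse x))) \<in> carrier_mat l l"
    using mult_mat_carrier by simp_all
  have AT: "transpose_mat A = four_block_mat (1\<^sub>m s) (0\<^sub>m s (l + l)) (0\<^sub>m (l + l) s)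
     (four_block_mat (transpose_mat (map_mat hom (mult_mat x))) (0\<^sub>m l l) (0\<^sub>m l l)
       (transpose_mat (map_mat hom (transpose_mat (mult_mat (inverse x))))))"
  proof (rule eq_matI, goal_cases)
    case (1 i j)
    then show ?case
      using mult_mat_carrier[of x] mult_mat_carrier[of "inverse x"] by (auto simp: A_def torus_mat_def)
  qed (use mult_mat_carrier[of x] mult_mat_carrier[of "inverse x"] in \<open>auto simp: A_def torus_mat_def\<close>)
  have "transpose_mat A *\<^sub>v c = 0\<^sub>v s @\<^sub>v (x \<cdot>\<^sub>v vec l b) @\<^sub>v 0\<^sub>v l"
  proof -
    let ?D = "four_block_mat (transpose_mat (map_mat hom (mult_mat x))) (0\<^sub>m l l) (0\<^sub>m l l)
       (transpose_mat (map_mat hom (transpose_mat (mult_mat (inverse x)))))"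
    have D: "?D \<in> carrier_mat (l + l) (l + l)" using M by (intro four_block_carrier_mat) auto
    have "?D *\<^sub>v (vec l b @\<^sub>v 0\<^sub>v l) = (x \<cdot>\<^sub>v vec l b) @\<^sub>v 0\<^sub>v l"
      using M eigenvector_mult_mat[OF assms(1)]
      by (subst mult_mat_vec_split[of _ l _ l]) auto
    then show ?thesis
      unfolding AT c_def using D by (subst mult_mat_vec_split[of _ s _ "l + l"]) auto
  qed
  also have "\<dots> = x \<cdot>\<^sub>v c" unfolding c_def by (intro eq_vecI) auto
  finally have ev: "transpose_mat A *\<^sub>v c = x \<cdot>\<^sub>v c" .
  \<comment> \<open>If every \<open>b i\<close> were 0, then \<open>elem\<close> would vanish,
    although \<open>elem (coords 1) = 1\<close>.\<close>
  have "c \<noteq> 0\<^sub>v ?n"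
  proof
    assume "c = 0\<^sub>v ?n"
    also have "0\<^sub>v ?n = 0\<^sub>v s @\<^sub>v 0\<^sub>v l @\<^sub>v 0\<^sub>v l" by (intro eq_vecI) auto
    finally have "vec l b = 0\<^sub>v l" by (simp add: c_def block_vec_eq_iff[of _ s _ _ l])
    then have "b i = 0" if "i < l" for i using that by (metis index_vec index_zero_vec(1))
    then have "elem (coords 1) = 0" unfolding elem_def by (intro sum.neutral) simp
    then show False using elem_coords[OF one_L] by simp
  qed
  then have "eigenvalue (transpose_mat A) x"
    unfolding eigenvalue_def eigenvector_def using ev A by (intro exI[of _ c]) (auto simp: c_def)
  then have "poly (char_poly (transpose_mat A)) x = 0"
    using A by (subst eigenvalue_root_char_poly[symmetric, of _ ?n]) auto
  then show ?thesis
    using A char_poly_hom[OF torus_mat_carrier] by (simp add: char_poly_transpose_mat A_def)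
qed

end

section \<open>Centralizers in the orthogonal group\<close>

text \<open>If \<open>h\<close> is one solution, then \<open>inv h \<otimes> g\<close> centralizes
  \<open>t\<close> for every solution \<open>g\<close>; the solutions thus lie in one coset of the
  centralizer.\<close>

lemma (in group) card_conjugating_le:
  assumes "finite (carrier G)" "t \<in> carrier G" "y \<in> carrier G"
  shows "card {g \<in> carrier G. g \<otimes> t = y \<otimes> g} \<le> card {g \<in> carrier G. g \<otimes> t = t \<otimes> g}"
proof (cases "{g \<in> carrier G. g \<otimes> t = y \<otimes> g} = {}")
  case False
  then obtain h where h: "h \<in> carrier G" "h \<otimes> t = y \<otimes> h" by blast
  have "inj_on (\<lambda>g. inv h \<otimes> g) {g \<in> carrier G. g \<otimes> t = y \<otimes> g}"
    using h by (auto intro!: inj_onI)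
  moreover have "(\<lambda>g. inv h \<otimes> g) ` {g \<in> carrier G. g \<otimes> t = y \<otimes> g} \<subseteq> {g \<in> carrier G. g \<otimes> t = t \<otimes> g}"
  proof safe
    fix g assume g: "g \<in> carrier G" "g \<otimes> t = y \<otimes> g"
    have t: "inv h \<otimes> (y \<otimes> h) = t"
      unfolding h(2)[symmetric] using h(1) assms by (simp add: m_assoc[symmetric])
    have hg: "h \<otimes> (inv h \<otimes> g) = g" using h(1) g(1) by (simp add: m_assoc[symmetric])
    have "inv h \<otimes> g \<otimes> t = inv h \<otimes> (y \<otimes> (h \<otimes> (inv h \<otimes> g)))"
      unfolding hg using g h(1) assms by (simp add: m_assoc)
    also have "\<dots> = inv h \<otimes> (y \<otimes> h) \<otimes> (inv h \<otimes> g)"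
      using g(1) h(1) assms by (simp only: m_assoc m_closed inv_closed)
    also note t
    finally show "inv h \<otimes> g \<otimes> t = t \<otimes> (inv h \<otimes> g)" .
    show "inv h \<otimes> g \<in> carrier G" using g h by simp
  qed
  ultimately show ?thesis using assms(1) by (intro card_inj_on_le[of "\<lambda>g. inv h \<otimes> g"]) auto
qed (simp only: card.empty)

lemma add_self_eq_self_vec:
  fixes u :: "'a::ab_group_add vec"
  assumes "u \<in> carrier_vec n" "u = u + u"
  shows "u = 0\<^sub>v n"
proof (rule eq_vecI)
  fix i assume i: "i < dim_vec (0\<^sub>v n :: 'a vec)"
  have "u $ i = u $ i + u $ i" using arg_cong[OF assms(2), of "\<lambda>v. vec_index v i"] i assms(1) by simp
  then show "u $ i = 0\<^sub>v n $ i" using i by simp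
qed (use assms in auto)

section \<open>Matrices commuting with the torus\<close>

context finite_extension
begin

lemma mult_mat_vec_cancel:
  assumes "x \<in> L" "x' \<in> L" "x \<noteq> x'" "c \<in> carrier_vec l"
    and "mult_mat x *\<^sub>v c = mult_mat x' *\<^sub>v c"
  shows "c = 0\<^sub>v l"
proof -
  have "x * elem c = x' * elem c" using assms elem_mult_mat by metis
  then have "elem c = elem (0\<^sub>v l)" using assms(3) by (simp add: elem_zero)
  then show ?thesis using assms(4) elem_inject by simp
qed

text \<open>Transposes do not act through \<open>elem\<close>, so \<open>c\<close> is tested against
  arbitrary \<open>a\<close>. As \<open>x - x'\<close> is invertible,
  \<open>a = mult_mat (x - x') *\<^sub>v e\<close> for some \<open>e\<close>, and moving the
  transposes across the dot product gives \<open>c \<bullet> a = 0\<close>.\<close>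

lemma transpose_mult_mat_vec_cancel:
  assumes "x \<in> L" "x' \<in> L" "x \<noteq> x'" "c \<in> carrier_vec l"
    and eq: "transpose_mat (mult_mat x) *\<^sub>v c = transpose_mat (mult_mat x') *\<^sub>v c"
  shows "c = 0\<^sub>v l"
proof (rule carrier_vec_eqI)
  fix a :: "'k vec" assume a: "a \<in> carrier_vec l"
  define d where "d = x - x'"
  have d: "d \<in> L" "d \<noteq> 0" "x = x' + d" using assms by (simp_all add: d_def diff_L)
  define e where "e = mult_mat (inverse d) *\<^sub>v a"
  have e: "e \<in> carrier_vec l" using a by (simp add: e_def)
  have "mult_mat d *\<^sub>v e = a"
    using a d by (intro mult_mat_eqI) (simp_all add: e_def elem_mult_mat inverse_L)
  then have x: "mult_mat x *\<^sub>v e = mult_mat x' *\<^sub>v e + a"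
    using d e assms mult_mat_carrier by (simp add: mult_mat_add add_mult_distrib_mat_vec[of _ l l])
  have "c \<bullet> (mult_mat x *\<^sub>v e) = c \<bullet> (mult_mat x' *\<^sub>v e)"
    using e assms(4) eq by (simp flip: transpose_vec_mult_scalar[OF mult_mat_carrier])
  then have "c \<bullet> a = 0"
    using assms(4) a e unfolding x by (simp add: scalar_prod_add_distrib[of _ l])
  then show "a \<bullet> c = a \<bullet> 0\<^sub>v l" using a assms(4) by (simp add: comm_scalar_prod[of _ l])
qed (use assms in auto)

text \<open>The equation \<open>inverse (y + 1) = inverse y + 1\<close> leads to
  \<open>y^2 + y + 1 = 0\<close>, which has at most two roots. Together with 0, 1 and -1 at most
  five elements are excluded.\<close>

lemma exists_generic_element:
  assumes "card L \<ge> 6"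
  obtains y where "y \<in> L" "y \<noteq> 0" "y \<noteq> 1" "y + 1 \<noteq> 0" "inverse (y + 1) \<noteq> inverse y + 1"
proof -
  define R where "R = {y. poly [:1, 1, 1:] y = (0 :: 'K)}"
  have "card R \<le> 2" "finite R"
    using card_poly_roots_bound[of "[:1, 1, 1 :: 'K:]"] poly_roots_finite[of "[:1, 1, 1 :: 'K:]"]
    by (simp_all add: R_def)
  then have "card ({0, 1, - 1} \<union> R) \<le> 5" "finite ({0, 1, - 1} \<union> R)"
    using card_Un_le[of "{0, 1, - 1}" R] card_length[of "[0, 1, - 1 :: 'K]"] by simp_all
  then have "\<not> L \<subseteq> {0, 1, - 1} \<union> R" using assms card_mono[of "{0, 1, - 1} \<union> R" L] by linarith
  then obtain y where y: "y \<in> L" "y \<noteq> 0" "y \<noteq> 1" "y \<noteq> - 1" "y \<notin> R" by auto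
  then have y1: "y + 1 \<noteq> 0" by (simp add: add_eq_0_iff2)
  have "inverse (y + 1) \<noteq> inverse y + 1"
  proof
    assume eq: "inverse (y + 1) = inverse y + 1"
    have "y = y * (y + 1) * inverse (y + 1)" using y1 by (simp add: mult.assoc)
    also have "\<dots> = y * (y + 1) * (inverse y + 1)" by (simp only: eq)
    also have "\<dots> = (y * inverse y) * (y + 1) + y * (y + 1)" by (simp add: distrib_left distrib_right mult_ac)
    also have "\<dots> = y + (1 + y * (1 + y))" using y(2) by (simp add: algebra_simps)
    finally have "1 + y * (1 + y) = 0" by (metis add_cancel_left_right)
    with y show False by (simp add: R_def)
  qed
  with y y1 show ?thesis by (intro that) auto
qed

text \<open>Picking \<open>y\<close> with \<open>(y + 1)\<^sup>-\<^sup>1 \<noteq> y\<^sup>-\<^sup>1 + 1\<close> separates the three blocks: the identity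
  \<open>t(y + 1) = t(y) + 1\<close> holds on the first isotropic block only.\<close>

lemma centralizer_torus_preserves_blocks:
  assumes L6: "card L \<ge> 6" and g: "g \<in> carrier_mat (s + (l + l)) (s + (l + l))"
    and comm: "\<And>y. y \<in> L \<Longrightarrow> y \<noteq> 0 \<Longrightarrow> g * torus_mat s y = torus_mat s y * g"
  shows "u \<in> carrier_vec s \<Longrightarrow> \<exists>u'\<in>carrier_vec s. g *\<^sub>v (u @\<^sub>v 0\<^sub>v l @\<^sub>v 0\<^sub>v l) = u' @\<^sub>v 0\<^sub>v l @\<^sub>v 0\<^sub>v l"
    and "v \<in> carrier_vec l \<Longrightarrow> \<exists>v'\<in>carrier_vec l. g *\<^sub>v (0\<^sub>v s @\<^sub>v v @\<^sub>v 0\<^sub>v l) = 0\<^sub>v s @\<^sub>v v' @\<^sub>v 0\<^sub>v l"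
    and "w \<in> carrier_vec l \<Longrightarrow> \<exists>w'\<in>carrier_vec l. g *\<^sub>v (0\<^sub>v s @\<^sub>v 0\<^sub>v l @\<^sub>v w) = 0\<^sub>v s @\<^sub>v 0\<^sub>v l @\<^sub>v w'"
proof -
  let ?n = "s + (l + l)"
  obtain y where y: "y \<in> L" "y \<noteq> 0" "y \<noteq> 1" "y + 1 \<noteq> 0" "inverse (y + 1) \<noteq> inverse y + 1"
    by (rule exists_generic_element[OF L6])
  have y1: "y + 1 \<in> L" and yi: "inverse y \<in> L" "inverse y + 1 \<in> L" "inverse (y + 1) \<in> L"
    using y by (auto intro: add_L inverse_L one_L)
  have gc: "g *\<^sub>v z \<in> carrier_vec ?n" if "z \<in> carrier_vec ?n" for z using g that by simp
  have tc: "torus_mat s x *\<^sub>v z \<in> carrier_vec ?n" if "z \<in> carrier_vec ?n" for z x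
    using torus_mat_carrier that by (rule mult_mat_vec_carrier)
  have gt: "g *\<^sub>v (torus_mat s x *\<^sub>v z) = torus_mat s x *\<^sub>v (g *\<^sub>v z)"
    if "x \<in> L" "x \<noteq> 0" "z \<in> carrier_vec ?n" for x z
    using comm[OF that(1,2)] that(3)
    by (metis assoc_mult_mat_vec[OF g torus_mat_carrier] assoc_mult_mat_vec[OF torus_mat_carrier g])
  have add1: "mult_mat (x + 1) *\<^sub>v c = mult_mat x *\<^sub>v c + c"
    "transpose_mat (mult_mat (x + 1)) *\<^sub>v c = transpose_mat (mult_mat x) *\<^sub>v c + c"
    if "x \<in> L" "c \<in> carrier_vec l" for x c
  proof -
    have "transpose_mat (mult_mat x + 1\<^sub>m l) = transpose_mat (mult_mat x) + 1\<^sub>m l"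
      using mult_mat_carrier[of x] by (intro eq_matI) auto
    then show "mult_mat (x + 1) *\<^sub>v c = mult_mat x *\<^sub>v c + c"
      "transpose_mat (mult_mat (x + 1)) *\<^sub>v c = transpose_mat (mult_mat x) *\<^sub>v c + c"
      using that mult_mat_carrier[of x]
      by (simp_all add: mult_mat_add one_L mult_mat_one add_mult_distrib_mat_vec[of _ l l])
  qed
  {
    assume u: "u \<in> carrier_vec s"
    define z where "z = u @\<^sub>v 0\<^sub>v l @\<^sub>v 0\<^sub>v l"
    have z: "z \<in> carrier_vec ?n" using u by (simp add: z_def)
    obtain u' v' w' where gz: "u' \<in> carrier_vec s" "v' \<in> carrier_vec l" "w' \<in> carrier_vec l"
      "g *\<^sub>v z = u' @\<^sub>v v' @\<^sub>v w'" using gc[OF z] by (rule block_vec_cases)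
    have 0: "transpose_mat (mult_mat x) *\<^sub>v 0\<^sub>v l = 0\<^sub>v l" "mult_mat x *\<^sub>v 0\<^sub>v l = 0\<^sub>v l" for x
      using mult_mat_carrier[of x] by (auto intro!: eq_vecI)
    \<comment> \<open>The torus fixes the unit block, while \<open>y \<noteq> 1\<close> leaves no
      nonzero fixed vector in the isotropic blocks.\<close>
    have "torus_mat s y *\<^sub>v z = z" using u by (simp add: z_def torus_mat_mult_vec 0)
    then have "torus_mat s y *\<^sub>v (g *\<^sub>v z) = g *\<^sub>v z" using gt[OF y(1,2) z] by simp
    then have "mult_mat y *\<^sub>v v' = mult_mat 1 *\<^sub>v v'"
      "transpose_mat (mult_mat (inverse y)) *\<^sub>v w' = transpose_mat (mult_mat 1) *\<^sub>v w'"
      using gz by (simp_all add: torus_mat_mult_vec block_vec_eq_iff[of _ s _ _ l] append_vec_eq[of _ l] mult_mat_one)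
    then have "v' = 0\<^sub>v l" "w' = 0\<^sub>v l"
      using gz y yi one_L mult_mat_vec_cancel[of y 1 v'] transpose_mult_mat_vec_cancel[of "inverse y" 1 w']
      by auto
    then show "\<exists>u'\<in>carrier_vec s. g *\<^sub>v (u @\<^sub>v 0\<^sub>v l @\<^sub>v 0\<^sub>v l) = u' @\<^sub>v 0\<^sub>v l @\<^sub>v 0\<^sub>v l"
      using gz unfolding z_def by blast
  next
    assume v: "v \<in> carrier_vec l"
    define z where "z = 0\<^sub>v s @\<^sub>v v @\<^sub>v 0\<^sub>v l"
    have z: "z \<in> carrier_vec ?n" using v by (simp add: z_def)
    obtain u' v' w' where gz: "u' \<in> carrier_vec s" "v' \<in> carrier_vec l" "w' \<in> carrier_vec l"
      "g *\<^sub>v z = u' @\<^sub>v v' @\<^sub>v w'" using gc[OF z] by (rule block_vec_cases)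
    have 0: "transpose_mat (mult_mat x) *\<^sub>v 0\<^sub>v l = 0\<^sub>v l" for x
      using mult_mat_carrier[of x] by (auto intro!: eq_vecI)
    \<comment> \<open>The image under \<open>g\<close> satisfies the same relation; its unit
      component then equals its own double, and its last component vanishes by the choice of
      \<open>y\<close>.\<close>
    have "torus_mat s (y + 1) *\<^sub>v z = torus_mat s y *\<^sub>v z + z"
      using v y by (simp add: z_def torus_mat_mult_vec 0 add1 block_vec_add[of _ s _ _ l])
    then have "torus_mat s (y + 1) *\<^sub>v (g *\<^sub>v z) = torus_mat s y *\<^sub>v (g *\<^sub>v z) + g *\<^sub>v z"
      using gt[OF y1 y(4) z] gt[OF y(1,2) z] mult_add_distrib_mat_vec[OF g tc[OF z] z] by simp
    then have "u' = u' + u'" "transpose_mat (mult_mat (inverse (y + 1))) *\<^sub>v w' =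
        transpose_mat (mult_mat (inverse y + 1)) *\<^sub>v w'"
      using gz yi
      by (simp_all add: torus_mat_mult_vec block_vec_add[of _ s _ _ l] block_vec_eq_iff[of _ s _ _ l] append_vec_eq[of _ l] add1)
    then have "u' = 0\<^sub>v s" "w' = 0\<^sub>v l"
      using gz y(5) yi add_self_eq_self_vec transpose_mult_mat_vec_cancel by blast+
    then show "\<exists>v'\<in>carrier_vec l. g *\<^sub>v (0\<^sub>v s @\<^sub>v v @\<^sub>v 0\<^sub>v l) = 0\<^sub>v s @\<^sub>v v' @\<^sub>v 0\<^sub>v l"
      using gz unfolding z_def by blast
  next
    assume w: "w \<in> carrier_vec l"
    define z where "z = 0\<^sub>v s @\<^sub>v 0\<^sub>v l @\<^sub>v w"
    have z: "z \<in> carrier_vec ?n" using w by (simp add: z_def)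
    obtain u' v' w' where gz: "u' \<in> carrier_vec s" "v' \<in> carrier_vec l" "w' \<in> carrier_vec l"
      "g *\<^sub>v z = u' @\<^sub>v v' @\<^sub>v w'" using gc[OF z] by (rule block_vec_cases)
    have 0: "mult_mat x *\<^sub>v 0\<^sub>v l = 0\<^sub>v l" for x
      using mult_mat_carrier[of x] by (auto intro!: eq_vecI)
    \<comment> \<open>The second block sees the inverse of the torus parameter, so the additive
      relation now holds for the parameters \<open>inverse (y + 1)\<close> and
      \<open>inverse y\<close>.\<close>
    have "torus_mat s (inverse (y + 1)) *\<^sub>v z = torus_mat s (inverse y) *\<^sub>v z + z"
      using w y by (simp add: z_def torus_mat_mult_vec 0 add1 block_vec_add[of _ s _ _ l])
    then have "torus_mat s (inverse (y + 1)) *\<^sub>v (g *\<^sub>v z) = torus_mat s (inverse y) *\<^sub>v (g *\<^sub>v z) + g *\<^sub>v z"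
      using gt[OF yi(3) _ z] gt[OF yi(1) _ z] y mult_add_distrib_mat_vec[OF g tc[OF z] z] by simp
    then have "u' = u' + u'" "mult_mat (inverse (y + 1)) *\<^sub>v v' = mult_mat (inverse y + 1) *\<^sub>v v'"
      using gz yi
      by (simp_all add: torus_mat_mult_vec block_vec_add[of _ s _ _ l] block_vec_eq_iff[of _ s _ _ l] append_vec_eq[of _ l] add1)
    then have "u' = 0\<^sub>v s" "v' = 0\<^sub>v l"
      using gz y(5) yi add_self_eq_self_vec mult_mat_vec_cancel by blast+
    then show "\<exists>w'\<in>carrier_vec l. g *\<^sub>v (0\<^sub>v s @\<^sub>v 0\<^sub>v l @\<^sub>v w) = 0\<^sub>v s @\<^sub>v 0\<^sub>v l @\<^sub>v w'"
      using gz unfolding z_def by blast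
  }
qed

text \<open>Every unit is a power of the generator \<open>x\<close>, and commuting passes to
  powers.\<close>

lemma torus_mat_commute_all:
  assumes "x \<in> primitive_elements" "g \<in> carrier_mat (s + (l + l)) (s + (l + l))"
    and "g * torus_mat s x = torus_mat s x * g" and "y \<in> L" "y \<noteq> 0"
  shows "g * torus_mat s y = torus_mat s y * g"
proof -
  note T = torus_mat_carrier
  have x: "x \<in> L" using assms(1) by (simp add: primitive_elements_def)
  obtain i :: nat where "y = x ^ i" using primitive_generates assms by blast
  moreover have "g * torus_mat s (x ^ i) = torus_mat s (x ^ i) * g"
  proof (induction i)
    case 0
    then show ?case using assms(2) by (simp add: torus_mat_one)
  next
    case (Suc i)
    have "g * torus_mat s (x ^ Suc i) = (g * torus_mat s x) * torus_mat s (x ^ i)"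
      using x assms(2) T by (simp add: torus_mat_mult[symmetric] power_L assoc_mult_mat[OF _ T T])
    also have "\<dots> = torus_mat s x * (g * torus_mat s (x ^ i))"
      unfolding assms(3) using assms(2) T by (simp add: assoc_mult_mat[OF T _ T])
    also have "\<dots> = torus_mat s (x ^ Suc i) * g"
      unfolding Suc using x assms(2) T by (simp add: torus_mat_mult[symmetric] power_L assoc_mult_mat[OF T T])
    finally show ?case .
  qed
  ultimately show ?thesis by simp
qed


text \<open>A single vector decides: its parts in the unit block and the first isotropic block are
  moved separately. The unit block is at most a line, the first isotropic block is generated by
  \<open>coords 1\<close> under the torus, and the form then fixes the action on the second.\<close>

lemma centralizer_isometry_eqI:
  assumes L6: "card L \<ge> 6" and "s \<le> 1"
    and g: "g \<in> isometries (s + (l + l)) (split_form s l)"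
    and g': "g' \<in> isometries (s + (l + l)) (split_form s l)"
    and comm: "\<And>y. y \<in> L \<Longrightarrow> y \<noteq> 0 \<Longrightarrow> g * torus_mat s y = torus_mat s y * g"
    and comm': "\<And>y. y \<in> L \<Longrightarrow> y \<noteq> 0 \<Longrightarrow> g' * torus_mat s y = torus_mat s y * g'"
    and eq: "g *\<^sub>v (vec s (\<lambda>_. 1) @\<^sub>v coords 1 @\<^sub>v 0\<^sub>v l) = g' *\<^sub>v (vec s (\<lambda>_. 1) @\<^sub>v coords 1 @\<^sub>v 0\<^sub>v l)"
  shows "g = g'"
proof -
  let ?n = "s + (l + l)" and ?B = "bilinear_form (split_form s l)"
  define e :: "'k vec" where "e = vec s (\<lambda>_. 1)"
  have e: "e \<in> carrier_vec s" by (simp add: e_def)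
  have c1: "coords 1 \<in> carrier_vec l" by (rule coords_carrier[OF one_L])
  have gc: "g \<in> carrier_mat ?n ?n" "g' \<in> carrier_mat ?n ?n"
    using g g' by (auto simp: isometries_def carrier_GL)
  note P = centralizer_torus_preserves_blocks[OF L6 gc(1) comm]
  note P' = centralizer_torus_preserves_blocks[OF L6 gc(2) comm']
  obtain u where u: "u \<in> carrier_vec s" "g *\<^sub>v (e @\<^sub>v 0\<^sub>v l @\<^sub>v 0\<^sub>v l) = u @\<^sub>v 0\<^sub>v l @\<^sub>v 0\<^sub>v l" using P(1)[OF _ _ e] by blast
  obtain u' where u': "u' \<in> carrier_vec s" "g' *\<^sub>v (e @\<^sub>v 0\<^sub>v l @\<^sub>v 0\<^sub>v l) = u' @\<^sub>v 0\<^sub>v l @\<^sub>v 0\<^sub>v l" using P'(1)[OF _ _ e] by blast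
  obtain v where v: "v \<in> carrier_vec l" "g *\<^sub>v (0\<^sub>v s @\<^sub>v coords 1 @\<^sub>v 0\<^sub>v l) = 0\<^sub>v s @\<^sub>v v @\<^sub>v 0\<^sub>v l" using P(2)[OF _ _ c1] by blast
  obtain v' where v': "v' \<in> carrier_vec l" "g' *\<^sub>v (0\<^sub>v s @\<^sub>v coords 1 @\<^sub>v 0\<^sub>v l) = 0\<^sub>v s @\<^sub>v v' @\<^sub>v 0\<^sub>v l" using P'(2)[OF _ _ c1] by blast
  have split: "e @\<^sub>v coords 1 @\<^sub>v 0\<^sub>v l = (e @\<^sub>v 0\<^sub>v l @\<^sub>v 0\<^sub>v l) + (0\<^sub>v s @\<^sub>v coords 1 @\<^sub>v 0\<^sub>v l)"
    using e c1 by (simp add: block_vec_add[of _ s _ _ l])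
  have E: "e @\<^sub>v 0\<^sub>v l @\<^sub>v 0\<^sub>v l \<in> carrier_vec ?n" "0\<^sub>v s @\<^sub>v coords 1 @\<^sub>v 0\<^sub>v l \<in> carrier_vec ?n"
    using e c1 by auto
  have "u @\<^sub>v v @\<^sub>v 0\<^sub>v l = u' @\<^sub>v v' @\<^sub>v 0\<^sub>v l"
  proof -
    have "u @\<^sub>v v @\<^sub>v 0\<^sub>v l = g *\<^sub>v (e @\<^sub>v coords 1 @\<^sub>v 0\<^sub>v l)"
      unfolding split mult_add_distrib_mat_vec[OF gc(1) E] u(2) v(2)
      using u v by (simp add: block_vec_add[of _ s _ _ l])
    also have "\<dots> = g' *\<^sub>v (e @\<^sub>v coords 1 @\<^sub>v 0\<^sub>v l)" using eq by (simp add: e_def)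
    also have "\<dots> = u' @\<^sub>v v' @\<^sub>v 0\<^sub>v l"
      unfolding split mult_add_distrib_mat_vec[OF gc(2) E] u'(2) v'(2)
      using u' v' by (simp add: block_vec_add[of _ s _ _ l])
    finally show ?thesis .
  qed
  then have uv: "u = u'" "v = v'" using u u' v v' by (simp_all add: block_vec_eq_iff[of _ s _ _ l])
  have on_U: "g *\<^sub>v (a @\<^sub>v 0\<^sub>v l @\<^sub>v 0\<^sub>v l) = g' *\<^sub>v (a @\<^sub>v 0\<^sub>v l @\<^sub>v 0\<^sub>v l)" if a: "a \<in> carrier_vec s" for a
  proof -
    \<comment> \<open>For \<open>s = 0\<close> the entry \<open>a $ 0\<close> is unspecified, but
      both sides are empty vectors.\<close>
    have "a = (a $ 0) \<cdot>\<^sub>v e"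
    proof (rule eq_vecI)
      fix i assume "i < dim_vec ((a $ 0) \<cdot>\<^sub>v e)"
      then have "i = 0" "0 < s" using \<open>s \<le> 1\<close> by (simp_all add: e_def)
      then show "a $ i = ((a $ 0) \<cdot>\<^sub>v e) $ i" by (simp add: e_def)
    qed (use a in \<open>simp add: e_def\<close>)
    moreover have "((a $ 0) \<cdot>\<^sub>v e) @\<^sub>v 0\<^sub>v l @\<^sub>v 0\<^sub>v l = (a $ 0) \<cdot>\<^sub>v (e @\<^sub>v 0\<^sub>v l @\<^sub>v 0\<^sub>v l)"
      by (intro eq_vecI) auto
    ultimately have "a @\<^sub>v 0\<^sub>v l @\<^sub>v 0\<^sub>v l = (a $ 0) \<cdot>\<^sub>v (e @\<^sub>v 0\<^sub>v l @\<^sub>v 0\<^sub>v l)" by metis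
    then show ?thesis
      using mult_mat_vec[OF gc(1) E(1)] mult_mat_vec[OF gc(2) E(1)] u(2) u'(2) uv by simp
  qed
  have on_V: "g *\<^sub>v (0\<^sub>v s @\<^sub>v a @\<^sub>v 0\<^sub>v l) = g' *\<^sub>v (0\<^sub>v s @\<^sub>v a @\<^sub>v 0\<^sub>v l)" if a: "a \<in> carrier_vec l" for a
  \<comment> \<open>The torus is indexed by units only, so the zero vector is treated apart.\<close>
  proof (cases "elem a = 0")
    case True
    then have "a = 0\<^sub>v l" using elem_inject[OF a zero_carrier_vec] elem_zero by simp
    then have "0\<^sub>v s @\<^sub>v a @\<^sub>v 0\<^sub>v l = 0\<^sub>v s @\<^sub>v 0\<^sub>v l @\<^sub>v 0\<^sub>v l" by simp
    then show ?thesis using on_U[of "0\<^sub>v s"] by simp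
  next
    case False
    have eL: "elem a \<in> L" by (rule elem_L[OF a])
    have 0: "transpose_mat (mult_mat x) *\<^sub>v 0\<^sub>v l = 0\<^sub>v l" for x
      using mult_mat_carrier[of x] by (auto intro!: eq_vecI)
    have a_eq: "0\<^sub>v s @\<^sub>v a @\<^sub>v 0\<^sub>v l = torus_mat s (elem a) *\<^sub>v (0\<^sub>v s @\<^sub>v coords 1 @\<^sub>v 0\<^sub>v l)"
      using a c1 by (simp add: torus_mat_mult_vec mult_mat_coords_one 0)
    show ?thesis
      unfolding a_eq
      using v(2) v'(2) uv comm[OF eL False] comm'[OF eL False]
      by (metis assoc_mult_mat_vec[OF gc(1) torus_mat_carrier E(2)] assoc_mult_mat_vec[OF torus_mat_carrier gc(1) E(2)]
          assoc_mult_mat_vec[OF gc(2) torus_mat_carrier E(2)] assoc_mult_mat_vec[OF torus_mat_carrier gc(2) E(2)])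
  qed
  \<comment> \<open>The inverse of \<open>g\<close> also commutes with the torus and so preserves
    the first isotropic block. Surjectivity lets the images serve as arbitrary test vectors for the
    pairing.\<close>
  have surj: "\<exists>a\<in>carrier_vec l. g *\<^sub>v (0\<^sub>v s @\<^sub>v a @\<^sub>v 0\<^sub>v l) = 0\<^sub>v s @\<^sub>v c @\<^sub>v 0\<^sub>v l" if c: "c \<in> carrier_vec l" for c
  proof -
    obtain h where h: "h \<in> carrier_mat ?n ?n" "h * g = 1\<^sub>m ?n" "g * h = 1\<^sub>m ?n"
      using g by (auto simp: isometries_def carrier_GL)
    have hcomm: "h * torus_mat s y = torus_mat s y * h" if y: "y \<in> L" "y \<noteq> 0" for y
    proof -
      define t where "t = torus_mat s y"
      have t: "t \<in> carrier_mat ?n ?n" unfolding t_def by (rule torus_mat_carrier)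
      have "h * t = h * (t * (g * h))" using t h by simp
      also have "\<dots> = h * (t * g) * h" using t h gc by (simp add: assoc_mult_mat[of _ ?n ?n _ ?n _ ?n])
      also have "t * g = g * t" using comm[OF y] by (simp add: t_def)
      also have "h * (g * t) * h = (h * g) * t * h"
        by (simp only: assoc_mult_mat[OF h(1) gc(1) t])
      also have "\<dots> = t * h" using t h by simp
      finally show ?thesis by (simp add: t_def)
    qed
    obtain a where a: "a \<in> carrier_vec l" "h *\<^sub>v (0\<^sub>v s @\<^sub>v c @\<^sub>v 0\<^sub>v l) = 0\<^sub>v s @\<^sub>v a @\<^sub>v 0\<^sub>v l"
      using centralizer_torus_preserves_blocks(2)[OF L6 h(1) hcomm c] by blast
    have C: "0\<^sub>v s @\<^sub>v c @\<^sub>v 0\<^sub>v l \<in> carrier_vec ?n" using c by auto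
    have "g *\<^sub>v (0\<^sub>v s @\<^sub>v a @\<^sub>v 0\<^sub>v l) = (g * h) *\<^sub>v (0\<^sub>v s @\<^sub>v c @\<^sub>v 0\<^sub>v l)"
      unfolding a(2)[symmetric] by (rule assoc_mult_mat_vec[OF gc(1) h(1) C, symmetric])
    then show ?thesis using a(1) h(3) C by auto
  qed
  \<comment> \<open>The form pairs the two isotropic blocks perfectly, so an isometry is determined on the second
    block by its action on the first.\<close>
  have on_W: "g *\<^sub>v (0\<^sub>v s @\<^sub>v 0\<^sub>v l @\<^sub>v w) = g' *\<^sub>v (0\<^sub>v s @\<^sub>v 0\<^sub>v l @\<^sub>v w)" if w: "w \<in> carrier_vec l" for w
  proof -
    obtain w1 where w1: "w1 \<in> carrier_vec l" "g *\<^sub>v (0\<^sub>v s @\<^sub>v 0\<^sub>v l @\<^sub>v w) = 0\<^sub>v s @\<^sub>v 0\<^sub>v l @\<^sub>v w1" using P(3)[OF _ _ w] by blast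
    obtain w2 where w2: "w2 \<in> carrier_vec l" "g' *\<^sub>v (0\<^sub>v s @\<^sub>v 0\<^sub>v l @\<^sub>v w) = 0\<^sub>v s @\<^sub>v 0\<^sub>v l @\<^sub>v w2" using P'(3)[OF _ _ w] by blast
    have "w1 = w2"
    proof (rule carrier_vec_eqI[OF w1(1) w2(1)])
      fix c :: "'k vec" assume c: "c \<in> carrier_vec l"
      obtain a where a: "a \<in> carrier_vec l" "g *\<^sub>v (0\<^sub>v s @\<^sub>v a @\<^sub>v 0\<^sub>v l) = 0\<^sub>v s @\<^sub>v c @\<^sub>v 0\<^sub>v l" using surj[OF c] by blast
      have A: "0\<^sub>v s @\<^sub>v a @\<^sub>v 0\<^sub>v l \<in> carrier_vec ?n" "0\<^sub>v s @\<^sub>v 0\<^sub>v l @\<^sub>v w \<in> carrier_vec ?n" using a w by auto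
      have pair: "?B (0\<^sub>v s @\<^sub>v c @\<^sub>v 0\<^sub>v l) (0\<^sub>v s @\<^sub>v 0\<^sub>v l @\<^sub>v d) = c \<bullet> d" if "d \<in> carrier_vec l" for d
        using c that by (simp add: bilinear_form_split_form)
      have iso: "?B (k *\<^sub>v y) (k *\<^sub>v z) = ?B y z"
        if "k \<in> isometries ?n (split_form s l)" "y \<in> carrier_vec ?n" "z \<in> carrier_vec ?n" for k y z
        using that by (simp add: isometries_def)
      from iso[OF g A] iso[OF g' A] show "c \<bullet> w1 = c \<bullet> w2"
        unfolding on_V[OF a(1), symmetric] a(2) w1(2) w2(2) pair[OF w1(1)] pair[OF w2(1)] by simp
    qed
    then show ?thesis using w1 w2 by simp
  qed
  show ?thesis using gc on_U on_V on_W by (intro block_mat_eqI) auto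
qed

text \<open>Evaluation at \<open>z\<close> is injective on the centralizer by
  \<open>centralizer_isometry_eqI\<close>, and the values have zero last block, leaving
  \<open>s + l\<close> free coordinates.\<close>

lemma card_centralizer_torus_le:
  assumes L6: "card L \<ge> 6" and "s \<le> 1" and x: "x \<in> primitive_elements"
  shows "card {g \<in> isometries (s + (l + l)) (split_form s l). g * torus_mat s x = torus_mat s x * g}
    \<le> card (UNIV :: 'k set) ^ (s + l)"
proof -
  define S where "S = {g \<in> isometries (s + (l + l)) (split_form s l). g * torus_mat s x = torus_mat s x * g}"
  define e :: "'k vec" where "e = vec s (\<lambda>_. 1)"
  define z where "z = e @\<^sub>v coords 1 @\<^sub>v 0\<^sub>v l"
  define D where "D = (carrier_vec s \<times> carrier_vec l :: ('k vec \<times> 'k vec) set)"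
  have e: "e \<in> carrier_vec s" by (simp add: e_def)
  have c1: "coords 1 \<in> carrier_vec l" by (rule coords_carrier[OF one_L])
  have SD: "g \<in> isometries (s + (l + l)) (split_form s l)" "g * torus_mat s x = torus_mat s x * g"
    if "g \<in> S" for g using that unfolding S_def by blast+
  have iso_carrier: "g \<in> carrier_mat (s + (l + l)) (s + (l + l))"
    if "g \<in> isometries (s + (l + l)) (split_form s l)" for g :: "'k mat"
    using that by (auto simp: isometries_def carrier_GL)
  have comm: "g * torus_mat s y = torus_mat s y * g" if "g \<in> S" "y \<in> L" "y \<noteq> 0" for g y
    using torus_mat_commute_all[OF x iso_carrier[OF SD(1)[OF that(1)]] SD(2)[OF that(1)]] that by simp
  have "inj_on (\<lambda>g. g *\<^sub>v z) S"
  proof (rule inj_onI)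
    fix g g' assume gg': "g \<in> S" "g' \<in> S" "g *\<^sub>v z = g' *\<^sub>v z"
    then show "g = g'"
      using centralizer_isometry_eqI[OF L6 \<open>s \<le> 1\<close> SD(1) SD(1) comm comm] unfolding z_def e_def by blast
  qed
  moreover have "(\<lambda>g. g *\<^sub>v z) ` S \<subseteq> (\<lambda>(u, v). u @\<^sub>v v @\<^sub>v 0\<^sub>v l) ` D"
  proof safe
    fix g assume g: "g \<in> S"
    have gc: "g \<in> carrier_mat (s + (l + l)) (s + (l + l))" by (rule iso_carrier[OF SD(1)[OF g]])
    note P = centralizer_torus_preserves_blocks[OF L6 gc comm[OF g]]
    obtain u where u: "u \<in> carrier_vec s" "g *\<^sub>v (e @\<^sub>v 0\<^sub>v l @\<^sub>v 0\<^sub>v l) = u @\<^sub>v 0\<^sub>v l @\<^sub>v 0\<^sub>v l" using P(1)[OF _ _ e] by blast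
    obtain v where v: "v \<in> carrier_vec l" "g *\<^sub>v (0\<^sub>v s @\<^sub>v coords 1 @\<^sub>v 0\<^sub>v l) = 0\<^sub>v s @\<^sub>v v @\<^sub>v 0\<^sub>v l" using P(2)[OF _ _ c1] by blast
    have split: "z = (e @\<^sub>v 0\<^sub>v l @\<^sub>v 0\<^sub>v l) + (0\<^sub>v s @\<^sub>v coords 1 @\<^sub>v 0\<^sub>v l)"
      using e c1 by (simp add: z_def block_vec_add[of _ s _ _ l])
    have E: "e @\<^sub>v 0\<^sub>v l @\<^sub>v 0\<^sub>v l \<in> carrier_vec (s + (l + l))" "0\<^sub>v s @\<^sub>v coords 1 @\<^sub>v 0\<^sub>v l \<in> carrier_vec (s + (l + l))"
      using e c1 by auto
    have "g *\<^sub>v z = u @\<^sub>v v @\<^sub>v 0\<^sub>v l"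
      unfolding split mult_add_distrib_mat_vec[OF gc E] u(2) v(2)
      using u v by (simp add: block_vec_add[of _ s _ _ l])
    then show "g *\<^sub>v z \<in> (\<lambda>(u, v). u @\<^sub>v v @\<^sub>v 0\<^sub>v l) ` D" using u v by (auto simp: D_def)
  qed
  moreover have finD: "finite D" by (simp add: D_def card_carrier_vec)
  ultimately have "card S \<le> card ((\<lambda>(u, v). u @\<^sub>v v @\<^sub>v 0\<^sub>v l) ` D)"
    by (intro card_inj_on_le[of "\<lambda>g. g *\<^sub>v z"]) auto
  also have "\<dots> \<le> card D" by (rule card_image_le[OF finD])
  also have "\<dots> = card (UNIV :: 'k set) ^ (s + l)"
    by (simp add: D_def card_cartesian_product card_carrier_vec power_add)
  finally show ?thesis by (simp add: S_def)
qed

section \<open>Orders and conjugates of torus elements\<close>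

lemma isometry_group_simps:
  "carrier (isometry_group n A) = isometries n A"
  "mult (isometry_group n A) = (*)" "one (isometry_group n A) = 1\<^sub>m n"
  for A :: "'k mat"
  by (simp_all add: isometry_group_def mult_GL one_GL)

text \<open>\<open>torus_mat s\<close> is multiplicative with trivial kernel on the units, so it
  preserves orders.\<close>

lemma ord_torus_mat:
  assumes "x \<in> primitive_elements"
  shows "group.ord (isometry_group (s + (l + l)) (split_form s l)) (torus_mat s x) = card L - 1"
proof -
  let ?G = "isometry_group (s + (l + l)) (split_form s l :: 'k mat)"
  interpret G: group ?G by (rule group_isometry_group)
  have x: "x \<in> L" "x \<noteq> 0" using assms by (auto simp: primitive_elements_def)
  have t: "torus_mat s x \<in> carrier ?G" using torus_mat_isometry[OF x] by (simp add: isometry_group_simps)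
  have "torus_mat s x [^]\<^bsub>?G\<^esub> i = torus_mat s (x ^ i)" for i :: nat
  proof (induction i)
    case (Suc i)
    then show ?case using x
      by (simp add: isometry_group_simps torus_mat_mult power_L mult.commute)
  qed (simp add: isometry_group_simps torus_mat_one)
  then have "torus_mat s x [^]\<^bsub>?G\<^esub> i = \<one>\<^bsub>?G\<^esub> \<longleftrightarrow> (card L - 1) dvd i" for i :: nat
    using x primitive_power_eq_1[OF assms, of i]
    by (simp add: isometry_group_simps torus_mat_eq_one_iff power_L)
  then show ?thesis using G.ord_unique[OF t] by blast
qed

text \<open>Instance of \<open>average_order_ge_conjugates\<close>: \<open>T\<close> is the image of
  the generators, \<open>c\<close> comes from the centralizer bound, and \<open>m\<close> is the
  dimension.\<close>

lemma average_order_split_form: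
  assumes L6: "card L \<ge> 6" and s: "s \<le> 1"
  shows "real ((card L - 1) * totient (card L - 1)) \<le>
    average_order (isometry_group (s + (l + l)) (split_form s l :: 'k mat)) *
      real ((s + (l + l)) * card (UNIV :: 'k set) ^ (s + l))"
proof -
  let ?n = "s + (l + l)"
  let ?G = "isometry_group ?n (split_form s l :: 'k mat)"
  interpret G: group ?G by (rule group_isometry_group)
  have car: "carrier ?G \<subseteq> carrier_mat ?n ?n"
    by (auto simp: isometry_group_simps isometries_def carrier_GL)
  have fin: "finite (carrier ?G)" by (rule finite_subset[OF car finite_carrier_mat])
  have inj: "inj_on (torus_mat s) (L - {0})"
  proof (rule inj_onI)
    fix x y assume xy: "x \<in> L - {0}" "y \<in> L - {0}" "torus_mat s x = torus_mat s y"
    then have "torus_mat s (x * inverse y) = torus_mat s (y * inverse y)"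
      using torus_mat_mult[of x "inverse y" s] torus_mat_mult[of y "inverse y" s] inverse_L by simp
    then have "torus_mat s (x * inverse y) = 1\<^sub>m ?n" using xy by (simp add: torus_mat_one)
    then have "x * inverse y = 1" using xy by (simp add: torus_mat_eq_one_iff mult_L inverse_L)
    then show "x = y" using xy by (simp add: field_simps)
  qed
  have prim: "primitive_elements \<subseteq> L - {0}" by (auto simp: primitive_elements_def)
  define T where "T = torus_mat s ` primitive_elements"
  have cardT: "card T = totient (card L - 1)"
    unfolding T_def using card_primitive_elements card_image[OF inj_on_subset[OF inj prim]] by simp
  have T: "T \<subseteq> carrier ?G"
    using prim torus_mat_isometry by (auto simp: T_def isometry_group_simps)
  have ord: "G.ord t = card L - 1" if "t \<in> T" for t
    using that ord_torus_mat by (auto simp: T_def)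
  have c: "card {g \<in> carrier ?G. g \<otimes>\<^bsub>?G\<^esub> t = y \<otimes>\<^bsub>?G\<^esub> g} \<le> card (UNIV :: 'k set) ^ (s + l)"
    if "t \<in> T" "y \<in> carrier ?G" for t y
    using G.card_conjugating_le[OF fin _ that(2), of t] that T card_centralizer_torus_le[OF L6 s]
    by (force simp: T_def isometry_group_simps)
  have m: "card {t \<in> T. \<exists>g\<in>carrier ?G. g \<otimes>\<^bsub>?G\<^esub> t = y \<otimes>\<^bsub>?G\<^esub> g} \<le> ?n" if y: "y \<in> carrier ?G" for y
  proof -
    have yc: "y \<in> carrier_mat ?n ?n" using y car by blast
    \<comment> \<open>Conjugate matrices share their characteristic polynomial, so every generator
      \<open>x\<close> whose torus element is conjugate to \<open>y\<close> is a root of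
      \<open>p\<close>.\<close>
    define p where "p = map_poly hom (char_poly y)"
    have p: "degree p \<le> ?n" "p \<noteq> 0"
    proof -
      show "degree p \<le> ?n"
        unfolding p_def using degree_map_poly_le[of hom "char_poly y"] degree_monic_char_poly[OF yc] by simp
      have "coeff p ?n = 1" using degree_monic_char_poly[OF yc] by (simp add: p_def)
      then show "p \<noteq> 0" by auto
    qed
    have "{t \<in> T. \<exists>g\<in>carrier ?G. g \<otimes>\<^bsub>?G\<^esub> t = y \<otimes>\<^bsub>?G\<^esub> g} \<subseteq> torus_mat s ` {x. poly p x = 0}"
    proof safe
      fix t g assume t: "t \<in> T" and g: "g \<in> carrier ?G" and gt: "g \<otimes>\<^bsub>?G\<^esub> t = y \<otimes>\<^bsub>?G\<^esub> g"
      obtain x where x: "x \<in> primitive_elements" "t = torus_mat s x" using t by (auto simp: T_def)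
      obtain h where h: "h \<in> carrier_mat ?n ?n" "h * g = 1\<^sub>m ?n" "g * h = 1\<^sub>m ?n" "g \<in> carrier_mat ?n ?n"
        using g by (auto simp: isometry_group_simps isometries_def carrier_GL)
      have tc: "t \<in> carrier_mat ?n ?n" using t T car by blast
      have "g * t * h = y * g * h" using gt by (simp add: isometry_group_simps)
      also have "\<dots> = y" using h yc by (simp add: assoc_mult_mat[OF yc h(4,1)])
      finally have "similar_mat_wit y t g h"
        using h yc tc unfolding similar_mat_wit_def Let_def by auto
      then have "char_poly y = char_poly t"
        by (intro char_poly_similar) (auto simp: similar_mat_def)
      then have "poly p x = 0"
        using torus_mat_eigenvalue[of x s] x prim by (auto simp: p_def)
      with x show "t \<in> torus_mat s ` {x. poly p x = 0}" by blast
    qed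
    then have "card {t \<in> T. \<exists>g\<in>carrier ?G. g \<otimes>\<^bsub>?G\<^esub> t = y \<otimes>\<^bsub>?G\<^esub> g} \<le> card (torus_mat s ` {x. poly p x = 0})"
      using poly_roots_finite[OF p(2)] by (intro card_mono) auto
    also have "\<dots> \<le> card {x. poly p x = 0}"
      using poly_roots_finite[OF p(2)] by (rule card_image_le)
    also have "\<dots> \<le> ?n" using card_poly_roots_bound[OF p(2)] p(1) by linarith
    finally show ?thesis .
  qed
  show ?thesis
    using average_order_ge_conjugates[OF G.group_axioms fin T ord c m] by (simp only: cardT)
qed

end

section \<open>The average order\<close>

lemma two_le_card_field: "card (UNIV :: 'k::{field,finite} set) \<ge> 2"
proof -
  have "card {0, 1 :: 'k} \<le> card (UNIV :: 'k set)" by (intro card_mono) auto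
  then show ?thesis by simp
qed

text \<open>The field of order \<open>Q ^ l\<close> contains the base field because
  \<open>c ^ Q = c\<close> there; comparing cardinalities shows that its dimension is
  \<open>l\<close>.\<close>

lemma exists_finite_extension:
  assumes "card (UNIV :: 'k::{field,finite} set) = CHAR('k) ^ k" "l > 0"
  shows "\<exists>(L :: 'k alg_closure set) b. finite_extension L to_ac l b"
proof -
  define Q where "Q = card (UNIV :: 'k set)"
  have Q: "Q > 1" unfolding Q_def using two_le_card_field[where 'k = 'k] by simp
  define L where "L = {x :: 'k alg_closure. x ^ (Q ^ l) = x}"
  have "k > 0" using assms(1) Q by (cases k) (auto simp: Q_def)
  then have L: "finite_subfield L" "card L = Q ^ l"
    using finite_subfield_alg_closure[of "Q ^ l" "k * l", where 'k = 'k] assms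
    by (simp_all add: L_def Q_def power_mult)
  interpret finite_subfield L by (rule L(1))
  interpret V: vector_space "\<lambda>(c :: 'k) x. to_ac c * x"
    by unfold_locales (simp_all add: algebra_simps)
  have "c ^ (Q ^ i) = c" for c :: 'k and i
    by (induction i) (simp_all add: power_mult power_card_eq_self Q_def)
  then have to_ac_L: "to_ac c \<in> L" for c by (simp add: L_def flip: to_ac_power)
  have "V.subspace L"
    unfolding V.subspace_def using zero_L add_L mult_L to_ac_L by blast
  then obtain b m where b: "bij_betw (\<lambda>c. \<Sum>i<m. to_ac (c $ i) * b i) (carrier_vec m) L"
    using V.finite_subspace_coordinates finite_L by blast
  have "Q ^ m = Q ^ l"
    using bij_betw_same_card[OF b] L(2) by (simp add: card_carrier_vec Q_def)
  then have "m = l" using Q by simp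
  with b have "finite_extension L to_ac l b"
    by unfold_locales auto
  then show ?thesis by blast
qed

lemma average_order_O_plus_ge:
  fixes n k :: nat
  defines "Q \<equiv> card (UNIV :: 'k::{field,finite} set)"
  assumes "Q = CHAR('k) ^ k" "n \<ge> 6"
  shows "real ((Q ^ (n div 2) - 1) * totient (Q ^ (n div 2) - 1)) \<le>
    average_order (O_plus TYPE('k) n) * real (n * Q ^ (n mod 2 + n div 2))"
proof -
  define l where "l = n div 2"
  have l: "l \<ge> 3" using assms by (simp add: l_def)
  have n: "n mod 2 + (l + l) = n" unfolding l_def by presburger
  obtain L :: "'k alg_closure set" and b where ext: "finite_extension L to_ac l b"
    using exists_finite_extension[of k l, where 'k = 'k] assms l by auto
  interpret finite_extension L to_ac l b by (rule ext)
  have "card L = Q ^ l" using card_L by (simp add: Q_def)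
  moreover have "Q ^ l \<ge> 6"
  proof -
    \<comment> \<open>\<open>n \<ge> 6\<close> gives \<open>l \<ge> 3\<close>, hence at least eight
      elements, enough for a generic one.\<close>
    have "(2::nat) ^ 3 \<le> 2 ^ l" using l by (intro power_increasing) auto
    also have "\<dots> \<le> Q ^ l" unfolding Q_def by (intro power_mono two_le_card_field) simp
    finally show ?thesis by simp
  qed
  ultimately show ?thesis
    using average_order_split_form[of "n mod 2"]
    by (simp add: O_plus_def O_plus_form_eq_split_form n flip: l_def Q_def)
qed

lemma average_order_nonneg: "average_order G \<ge> 0"
  unfolding average_order_def by (intro divide_nonneg_nonneg sum_nonneg) auto

text \<open>The error collects three losses: \<open>3 / 2 * ln Q\<close> from rounding
  \<open>n / 2\<close> down to \<open>l\<close> and from the unit block, \<open>ln 4\<close> from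
  bounding \<open>Q ^ l - 1\<close> below by \<open>Q ^ l / 2\<close> twice, and the rest from the
  totient.\<close>

lemma ln_average_order_O_plus_ge:
  fixes n k :: nat
  defines "Q \<equiv> card (UNIV :: 'k::{field,finite} set)"
  assumes Q: "Q = CHAR('k) ^ k" and n: "n \<ge> 6"
  shows "average_order (O_plus TYPE('k) n) > 0" (is "?a > 0")
    and "ln (average_order (O_plus TYPE('k) n)) \<ge> real n / 2 * ln Q - ln n
      - (3 / 2 * ln Q + 8 + ln 4 + 4 * ln (log 2 (Q * n) + 1))"
proof -
  define l s where "l = n div 2" and "s = n mod 2"
  have l: "l \<ge> 3" and s: "s \<le> 1" and ls: "real l = real n / 2 - real s / 2" "l \<le> n"
  proof -
    have "n = 2 * l + s" by (simp add: l_def s_def)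
    then show "real l = real n / 2 - real s / 2" "l \<le> n" by simp_all
  qed (use n in \<open>simp_all add: l_def s_def\<close>)
  have Q2: "Q \<ge> 2"
    unfolding Q_def by (rule two_le_card_field)
  define N where "N = Q ^ l - 1"
  have Ql: "Q ^ l \<ge> 2" using Q2 l power_increasing[of 1 l Q] by simp
  have N1: "N \<ge> 1" using Ql by (simp add: N_def)
  have NQ: "real N \<ge> real Q ^ l / 2" using Ql by (simp add: N_def of_nat_diff flip: of_nat_power)
  define x where "x = log 2 (Q * n)"
  have Qn: "real Q * real n \<ge> 2 * 1" using Q2 n by (intro mult_mono) auto
  have x1: "x \<ge> 1" using Qn by (simp add: x_def)
  \<comment> \<open>This makes \<open>Q * n \<le> 2 ^ J\<close>, which meets the hypothesis of
    \<open>totient_lower_bound\<close>, while \<open>J \<le> log 2 (Q * n) + 1\<close> keeps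
    \<open>ln J\<close> doubly logarithmic in \<open>n\<close>.\<close>
  define J where "J = nat \<lceil>x\<rceil>"
  have J: "J \<ge> 1" "real J \<le> x + 1" "x \<le> real J" using x1 by (auto simp: J_def) linarith+
  have "real (Q * n) \<le> 2 ^ J"
  proof -
    have "real Q * real n = 2 powr x" using Qn by (simp add: x_def)
    also have "\<dots> \<le> 2 powr real J" using J by simp
    finally show ?thesis by (simp add: powr_realpow)
  qed
  then have QnJ: "Q * n \<le> 2 ^ J" by (metis of_nat_le_iff of_nat_numeral of_nat_power)
  have "N \<le> Q ^ l" by (simp add: N_def)
  \<comment> \<open>The crude \<open>Q < 2 ^ Q\<close> is harmless: for fixed \<open>Q\<close> it
    only changes a constant inside the double logarithm.\<close>
  also have "\<dots> \<le> (2 ^ Q) ^ l" using less_exp[of Q] by (intro power_mono) auto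
  also have "\<dots> = 2 ^ (Q * l)" by (simp add: power_mult)
  also have "\<dots> \<le> 2 ^ (2 ^ Suc J)"
  proof (rule power_increasing)
    have "Q * l \<le> Q * n" using ls(2) by simp
    then show "Q * l \<le> 2 ^ Suc J" unfolding power_Suc using QnJ by linarith
  qed simp
  finally have "real (totient N) \<ge> real N * exp (- 8 - 4 * ln (real J))"
    by (intro totient_lower_bound N1 J(1))
  then have "real N * (real N * exp (- 8 - 4 * ln (real J))) \<le> real N * real (totient N)"
    by (intro mult_left_mono) auto
  also have "\<dots> \<le> ?a * (real n * real Q ^ (s + l))"
    using average_order_O_plus_ge[of k n, where 'k = 'k] Q n by (simp add: N_def l_def s_def Q_def)
  finally have "real N * real N * exp (- 8 - 4 * ln (real J)) \<le> ?a * (real n * real Q ^ (s + l))" by simp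
  moreover have "(real Q ^ l / 2) * (real Q ^ l / 2) * exp (- 8 - 4 * ln (real J)) \<le>
      real N * real N * exp (- 8 - 4 * ln (real J))"
    using NQ by (intro mult_right_mono mult_mono) auto
  ultimately have "(real Q ^ l / 2) * (real Q ^ l / 2) * exp (- 8 - 4 * ln (real J)) \<le> ?a * (real n * real Q ^ (s + l))"
    by linarith
  then have *: "real Q ^ l * exp (- 8 - 4 * ln (real J)) / (4 * real n * real Q ^ s) \<le> ?a"
    using Q2 n by (simp add: field_simps power_add)
  have pos: "real Q ^ l * exp (- 8 - 4 * ln (real J)) / (4 * real n * real Q ^ s) > 0" using Q2 n by simp
  with * show a: "?a > 0" by linarith
  have "ln (real J) \<le> ln (x + 1)" using J by simp
  moreover have "real s * ln (real Q) \<le> 1 * ln (real Q)" using s Q2 by (intro mult_right_mono) auto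
  ultimately have "real n / 2 * ln Q - ln n - (3 / 2 * ln Q + 8 + ln 4 + 4 * ln (x + 1)) \<le>
      real l * ln Q + (- 8 - 4 * ln (real J)) - (ln 4 + ln n + real s * ln Q)"
    unfolding ls(1) by (simp add: algebra_simps)
  also have "\<dots> = ln (real Q ^ l * exp (- 8 - 4 * ln (real J)) / (4 * real n * real Q ^ s))"
    using Q2 n by (simp add: ln_div ln_mult ln_realpow)
  also have "\<dots> \<le> ln ?a" using * pos a by simp
  finally show "ln ?a \<ge> real n / 2 * ln Q - ln n - (3 / 2 * ln Q + 8 + ln 4 + 4 * ln (log 2 (Q * n) + 1))"
    by (simp add: x_def)
qed

theorem theorem27:
  fixes \<delta> :: "'k::{field, finite}" and p k q :: nat
  assumes "prime p" and "odd p" and "k \<ge> 1" and "q = p ^ k"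
    and "card (UNIV :: 'k set) = q"
    and "\<not> (\<exists>x :: 'k. \<delta> = x ^ 2)"
  shows "\<exists>h :: nat \<Rightarrow> real. h \<in> o(\<lambda>n. ln (real n)) \<and>
    (\<forall>\<^sub>F n in sequentially.
       ln (v_O \<delta> n) \<ge> real n / 2 * ln (real q) - ln (real n) + h n)"
proof -
  \<comment> \<open>The characteristic is a prime dividing the cardinality, hence equals
    \<open>p\<close>.\<close>
  have "CHAR('k) dvd p ^ k" using CHAR_dvd_CARD[where 'a = 'k] assms by simp
  then have "CHAR('k) = p"
    using prime_CHAR_finite_field[where 'k = 'k] assms(1) by (metis prime_dvd_power primes_dvd_imp_eq)
  then have Q: "card (UNIV :: 'k set) = CHAR('k) ^ k" using assms by simp
  have q: "real q > 0" using assms by (simp add: prime_gt_0_nat)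
  \<comment> \<open>The final \<open>ln 2\<close> pays for the factor 1/2 in
    \<open>v_O\<close>.\<close>
  define h :: "nat \<Rightarrow> real" where
    "h n = - (3 / 2 * ln q + 8 + ln 4 + 4 * ln (log 2 (q * n) + 1)) - ln 2" for n
  have "h \<in> o(\<lambda>n. ln (real n))" using q unfolding h_def by real_asymp
  moreover have "ln (v_O \<delta> n) \<ge> real n / 2 * ln (real q) - ln (real n) + h n" if "n \<ge> 6" for n
  proof -
    define a where "a = average_order (O_plus TYPE('k) n)"
    note a = ln_average_order_O_plus_ge[OF Q that, folded a_def]
    \<comment> \<open>The average over \<open>O_minus\<close> is nonnegative, so \<open>v_O\<close>
      is at least half the average over \<open>O_plus\<close>.\<close>
    have "ln (a / 2) \<le> ln (v_O \<delta> n)"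
      using a(1) average_order_nonneg[of "O_minus \<delta> n"] by (simp add: v_O_def a_def)
    moreover have "ln (a / 2) = ln a - ln 2" using a(1) by (simp add: ln_div)
    ultimately show ?thesis using a(2) assms(5) by (simp add: h_def)
  qed
  ultimately show ?thesis unfolding eventually_sequentially by blast
qed

end
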